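(* Let $p$ be a prime, $S$ a finite $p$-group, and $\mathcal{G}\le\mathcal{F}$ two saturated fusion systems on $S$ (i.e. $\operatorname{Hom}_\mathcal{G}(P,Q)\subseteq\operatorname{Hom}_\mathcal{F}(P,Q)$ for all $P,Q\le S$). Suppose that $\operatorname{Hom}_\mathcal{G}(A,B)=\operatorname{Hom}_\mathcal{F}(A,B)$ for all subgroups $A,B\le S$ that are elementary abelian if $p$ is odd, and abelian of exponent at most $4$ if $p=2$. Then $\mathcal{G}=\mathcal{F}$.
   Context: Let $S$ be a finite $p$-group. A fusion system $\mathcal F$ on $S$ is a category whose objects are the subgroups of $S$ and whose morphism sets $\operatorname{Hom}_\mathcal F(P,Q)$ are sets of injective group homomorphisms $P\to Q$, such that (i) every homomorphism $P\to Q$ of the form $x\mapsto gxg^{-1}$ with $g\in S$ lies in $\operatorname{Hom}_\mathcal F(P,Q)$, and (ii) every $\varphi\in\operatorname{Hom}_\mathcal F(P,Q)$ factors as an isomorphism $P\to\varphi(P)$ in $\mathcal F$ whose inverse lies in $\mathcal F$, followed by the inclusion $\varphi(P)\le Q$; morphisms compose as functions. Write $\operatorname{Aut}_\mathcal F(P)=\operatorname{Hom}_\mathcal F(P,P)$ and $\operatorname{Aut}_S(P)$ for the automorphisms of $P$ induced by conjugation by elements of $N_S(P)$. Subgroups isomorphic in $\mathcal F$ are called $\mathcal F$-conjugate. $Q\le S$ is fully $\mathcal F$-normalized (resp. fully $\mathcal F$-centralized) if $|N_S(Q)|\ge|N_S(Q')|$ (resp. $|C_S(Q)|\ge|C_S(Q')|$)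 for all $\mathcal F$-conjugates $Q'$ of $Q$. For $\varphi\in\operatorname{Hom}_\mathcal F(Q,S)$ put $N_\varphi=\{g\in N_S(Q): \varphi\circ c_g|_Q\circ\varphi^{-1}\in\operatorname{Aut}_S(\varphi(Q))\}$, where $c_g(x)=gxg^{-1}$. $\mathcal F$ is saturated if (Sylow axiom) every fully $\mathcal F$-normalized $Q$ is fully $\mathcal F$-centralized and $\operatorname{Aut}_S(Q)$ is a Sylow $p$-subgroup of $\operatorname{Aut}_\mathcal F(Q)$, and (extension axiom) every $\varphi\in\operatorname{Hom}_\mathcal F(Q,S)$ with $\varphi(Q)$ fully $\mathcal F$-centralized extends to a morphism in $\operatorname{Hom}_\mathcal F(N_\varphi,S)$. *)

theory Defs
  imports "HOL-Algebra.Group_Action" "HOL-Computational_Algebra.Primes"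
begin

text \<open>A fusion system on a group S is modelled as a function
  F :: 'a set => 'a set => ('a => 'a) set giving the morphism sets Hom_F(P,Q);
  it is empty unless P and Q are subgroups of S. Morphisms are functions that
  are extensional on their domain (value undefined outside P).\<close>

definition p_group :: "nat \<Rightarrow> ('a, 'b) monoid_scheme \<Rightarrow> bool" where
  "p_group p S \<longleftrightarrow> prime p \<and> group S \<and> finite (carrier S) \<and> (\<exists>n. card (carrier S) = p ^ n)"

definition conjmap :: "('a, 'b) monoid_scheme \<Rightarrow> 'a \<Rightarrow> 'a set \<Rightarrow> ('a \<Rightarrow> 'a)" where
  "conjmap S g P = (\<lambda>x\<in>P. g \<otimes>\<^bsub>S\<^esub> x \<otimes>\<^bsub>S\<^esub> inv\<^bsub>S\<^esub> g)"

definition inj_homs :: "('a, 'b) monoid_scheme \<Rightarrow> 'a set \<Rightarrow> 'a set \<Rightarrow> ('a \<Rightarrow> 'a) set" where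
  "inj_homs S P Q = {\<phi>. \<phi> \<in> hom (S\<lparr>carrier := P\<rparr>) (S\<lparr>carrier := Q\<rparr>) \<and> inj_on \<phi> P \<and> \<phi> \<in> extensional P}"

definition morph_inv :: "'a set \<Rightarrow> ('a \<Rightarrow> 'a) \<Rightarrow> ('a \<Rightarrow> 'a)" where
  "morph_inv P \<phi> = (\<lambda>y\<in>\<phi> ` P. inv_into P \<phi> y)"

definition fusion_system :: "('a, 'b) monoid_scheme \<Rightarrow> ('a set \<Rightarrow> 'a set \<Rightarrow> ('a \<Rightarrow> 'a) set) \<Rightarrow> bool" where
  "fusion_system S F \<longleftrightarrow>
     (\<forall>P Q. \<not> (subgroup P S \<and> subgroup Q S) \<longrightarrow> F P Q = {}) \<and>
     (\<forall>P Q. subgroup P S \<and> subgroup Q S \<longrightarrow> F P Q \<subseteq> inj_homs S P Q) \<and>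
     \<comment> \<open>(i) conjugation by elements of S\<close>
     (\<forall>P Q g. subgroup P S \<and> subgroup Q S \<and> g \<in> carrier S \<and> conjmap S g P ` P \<subseteq> Q
        \<longrightarrow> conjmap S g P \<in> F P Q) \<and>
     \<comment> \<open>(ii) factorisation: isomorphism onto the image with inverse in F, then inclusion\<close>
     (\<forall>P Q \<phi>. \<phi> \<in> F P Q \<longrightarrow> \<phi> \<in> F P (\<phi> ` P) \<and> morph_inv P \<phi> \<in> F (\<phi> ` P) P) \<and>
     \<comment> \<open>category: closed under composition\<close>
     (\<forall>P Q R \<phi> \<psi>. \<phi> \<in> F P Q \<and> \<psi> \<in> F Q R \<longrightarrow> (\<lambda>x\<in>P. \<psi> (\<phi> x)) \<in> F P R)"

definition Aut_F :: "('a set \<Rightarrow> 'a set \<Rightarrow> ('a \<Rightarrow> 'a) set) \<Rightarrow> 'a set \<Rightarrow> ('a \<Rightarrow> 'a) set" where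
  "Aut_F F P = F P P"

definition Aut_S :: "('a, 'b) monoid_scheme \<Rightarrow> 'a set \<Rightarrow> ('a \<Rightarrow> 'a) set" where
  "Aut_S S P = (\<lambda>g. conjmap S g P) ` normalizer S P"

definition centralizer :: "('a, 'b) monoid_scheme \<Rightarrow> 'a set \<Rightarrow> 'a set" where
  "centralizer S P = {g \<in> carrier S. \<forall>x\<in>P. g \<otimes>\<^bsub>S\<^esub> x = x \<otimes>\<^bsub>S\<^esub> g}"

definition F_conjugate :: "('a set \<Rightarrow> 'a set \<Rightarrow> ('a \<Rightarrow> 'a) set) \<Rightarrow> 'a set \<Rightarrow> 'a set \<Rightarrow> bool" where
  "F_conjugate F P Q \<longleftrightarrow> (\<exists>\<phi> \<in> F P Q. \<phi> ` P = Q \<and> morph_inv P \<phi> \<in> F Q P)"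

definition fully_normalized :: "('a, 'b) monoid_scheme \<Rightarrow> ('a set \<Rightarrow> 'a set \<Rightarrow> ('a \<Rightarrow> 'a) set) \<Rightarrow> 'a set \<Rightarrow> bool" where
  "fully_normalized S F Q \<longleftrightarrow> subgroup Q S \<and>
     (\<forall>Q'. F_conjugate F Q Q' \<longrightarrow> card (normalizer S Q') \<le> card (normalizer S Q))"

definition fully_centralized :: "('a, 'b) monoid_scheme \<Rightarrow> ('a set \<Rightarrow> 'a set \<Rightarrow> ('a \<Rightarrow> 'a) set) \<Rightarrow> 'a set \<Rightarrow> bool" where
  "fully_centralized S F Q \<longleftrightarrow> subgroup Q S \<and>
     (\<forall>Q'. F_conjugate F Q Q' \<longrightarrow> card (centralizer S Q') \<le> card (centralizer S Q))"

definition N_phi :: "('a, 'b) monoid_scheme \<Rightarrow> 'a set \<Rightarrow> ('a \<Rightarrow> 'a) \<Rightarrow> 'a set" where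
  "N_phi S Q \<phi> = {g \<in> normalizer S Q.
      (\<lambda>y\<in>\<phi> ` Q. \<phi> (conjmap S g Q (morph_inv Q \<phi> y))) \<in> Aut_S S (\<phi> ` Q)}"

text \<open>Sylow p-subgroup H of a finite group K (H a subgroup of K, given here as sets):
  |H| is the full p-part of |K|.\<close>
definition sylow_in :: "nat \<Rightarrow> 'c set \<Rightarrow> 'c set \<Rightarrow> bool" where
  "sylow_in p H K \<longleftrightarrow> H \<subseteq> K \<and> finite K \<and> card H = p ^ multiplicity p (card K)"

definition saturated_fusion_system :: "nat \<Rightarrow> ('a, 'b) monoid_scheme \<Rightarrow> ('a set \<Rightarrow> 'a set \<Rightarrow> ('a \<Rightarrow> 'a) set) \<Rightarrow> bool" where
  "saturated_fusion_system p S F \<longleftrightarrow> fusion_system S F \<and>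
     \<comment> \<open>Sylow axiom\<close>
     (\<forall>Q. fully_normalized S F Q \<longrightarrow>
        fully_centralized S F Q \<and> sylow_in p (Aut_S S Q) (Aut_F F Q)) \<and>
     \<comment> \<open>extension axiom\<close>
     (\<forall>Q \<phi>. \<phi> \<in> F Q (carrier S) \<and> fully_centralized S F (\<phi> ` Q) \<longrightarrow>
        (\<exists>\<psi> \<in> F (N_phi S Q \<phi>) (carrier S). \<forall>x\<in>Q. \<psi> x = \<phi> x))"

definition elementary_abelian :: "nat \<Rightarrow> ('a, 'b) monoid_scheme \<Rightarrow> 'a set \<Rightarrow> bool" where
  "elementary_abelian p S A \<longleftrightarrow> subgroup A S \<and>
     (\<forall>x\<in>A. \<forall>y\<in>A. x \<otimes>\<^bsub>S\<^esub> y = y \<otimes>\<^bsub>S\<^esub> x) \<and> (\<forall>x\<in>A. x [^]\<^bsub>S\<^esub> p = \<one>\<^bsub>S\<^esub>)"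

definition abelian_exp_le_4 :: "('a, 'b) monoid_scheme \<Rightarrow> 'a set \<Rightarrow> bool" where
  "abelian_exp_le_4 S A \<longleftrightarrow> subgroup A S \<and>
     (\<forall>x\<in>A. \<forall>y\<in>A. x \<otimes>\<^bsub>S\<^esub> y = y \<otimes>\<^bsub>S\<^esub> x) \<and> (\<forall>x\<in>A. x [^]\<^bsub>S\<^esub> (4::nat) = \<one>\<^bsub>S\<^esub>)"

definition test_subgroup :: "nat \<Rightarrow> ('a, 'b) monoid_scheme \<Rightarrow> 'a set \<Rightarrow> bool" where
  "test_subgroup p S A \<longleftrightarrow> (if p = 2 then abelian_exp_le_4 S A else elementary_abelian p S A)"

end

theory Submission
  imports Defs "HOL-Algebra.Sylow" "HOL-Algebra.Generated_Groups" "HOL-Algebra.Multiplicative_Group"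
begin

text \<open>
  Induct downwards on \<open>|P|\<close> to show that every \<open>\<F>\<close>-morphism on \<open>P\<close> lies in \<open>\<G>\<close>. Morphisms on
  larger subgroups being known, the Sylow and extension axioms reduce the claim to the automorphisms
  \<open>A = Aut\<^sub>\<F>(P)\<close> of a fully normalized \<open>P\<close>. Let \<open>E\<close> be a maximal element of the set of normal
  subgroups of \<open>N\<^sub>S(P)\<close> that lie in \<open>P\<close> and are abelian of exponent dividing \<open>p\<close> (or \<open>4\<close>). By a theorem of
  Alperin, \<open>E\<close> contains every element of \<open>C\<^sub>P(E)\<close> of this exponent, so a \<open>p'\<close>-automorphism of \<open>P\<close>
  which is trivial on \<open>E\<close> is trivial: a minimal invariant subgroup of \<open>C\<^sub>P(E)\<close> on which it acts
  nontrivially has class at most \<open>2\<close> and would provide a moved element of small order. Therefore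
  \<open>C\<^sub>A(E)\<close> is a \<open>p\<close>-group, and since \<open>Aut\<^sub>S(P)\<close> normalizes it, it is contained in \<open>Aut\<^sub>S(P)\<close>.

  Replacing \<open>(P, E)\<close> by a \<open>\<G>\<close>-conjugate, \<open>E\<close> is fully \<open>\<G>\<close>-normalized. For \<open>\<phi> \<in> A\<close> the map
  \<open>\<phi>\<^sup>-\<^sup>1 : \<phi>(E) \<rightarrow> E\<close> is in \<open>\<G>\<close> by hypothesis and extends in \<open>\<G>\<close> to \<open>\<psi>\<close> on \<open>P\<close>. The \<open>\<F>\<close>-isomorphism
  \<open>\<gamma> = \<phi>\<^sup>-\<^sup>1 \<psi>\<^sup>-\<^sup>1 : \<psi>(P) \<rightarrow> P\<close> fixes \<open>E\<close>, so it conjugates the automorphisms induced by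
  \<open>C\<^sub>S(E)\<close> into \<open>C\<^sub>A(E) \<le> Aut\<^sub>S(P)\<close> and hence extends to \<open>\<psi>(P) C\<^sub>S(E) \<inter> N\<^sub>S(\<psi>(P))\<close>. Either this group is
  larger than \<open>\<psi>(P)\<close> and \<open>\<gamma>\<close> is in \<open>\<G>\<close> by induction, or \<open>C\<^sub>S(E) \<le> \<psi>(P) = P\<close> and \<open>\<gamma>\<close> is in
  \<open>C\<^sub>A(E)\<close>.
\<close>

section \<open>Finite \<open>p\<close>-groups\<close>

text \<open>A nontrivial orbit of a p-group has size a positive power of \<open>p\<close>. Counting
  moved points instead of fixed ones turns this into a plain divisibility. The action is a bare
  function with laws on \<open>X\<close> only, so that it can be instantiated directly by operations
  on cosets.\<close>

lemma p_dvd_card_nonfixed: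
  assumes H: "group H" "card (carrier H) = p ^ k" "prime (p::nat)" and X: "finite X"
    and cl: "\<And>h x. h \<in> carrier H \<Longrightarrow> x \<in> X \<Longrightarrow> act h x \<in> X"
    and one: "\<And>x. x \<in> X \<Longrightarrow> act \<one>\<^bsub>H\<^esub> x = x"
    and mult: "\<And>g h x. g \<in> carrier H \<Longrightarrow> h \<in> carrier H \<Longrightarrow> x \<in> X \<Longrightarrow>
                 act (g \<otimes>\<^bsub>H\<^esub> h) x = act g (act h x)"
  shows "p dvd card {x \<in> X. \<exists>h \<in> carrier H. act h x \<noteq> x}"
proof -
  interpret H: group H by fact
  let ?a = "\<lambda>h. restrict (act h) X"
  have inv1: "act (inv\<^bsub>H\<^esub> h) (act h x) = x" "act h (act (inv\<^bsub>H\<^esub> h) x) = x"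
    if "h \<in> carrier H" "x \<in> X" for h x
    using that mult[of "inv\<^bsub>H\<^esub> h" h x] mult[of h "inv\<^bsub>H\<^esub> h" x] one by auto
  have bij: "?a h \<in> Bij X" if h: "h \<in> carrier H" for h
  proof -
    have "bij_betw (act h) X X"
      by (rule bij_betwI[where g = "act (inv\<^bsub>H\<^esub> h)"]) (use h cl inv1 in auto)
    then show ?thesis by (auto simp: Bij_def cong: bij_betw_cong)
  qed
  interpret group_action H X ?a
  proof (unfold group_action_def, rule group_hom.intro)
    show "group H" by fact
    show "group (BijGroup X)" by (rule group_BijGroup)
    show "group_hom_axioms H (BijGroup X) ?a"
      by unfold_locales (auto simp: hom_def BijGroup_def bij compose_def mult cl intro!: restrict_ext)
  qed
  \<comment> \<open>An orbit on which \<open>?f\<close> vanishes somewhere is a singleton, so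
    \<open>?f\<close> is constant on every orbit.\<close>
  let ?f = "\<lambda>x. if \<exists>h \<in> carrier H. act h x \<noteq> x then 1 else 0 :: nat"
  have "p dvd (\<Sum>x\<in>orb. ?f x)" if orb: "orb \<in> orbits H X ?a" for orb
  proof -
    obtain x where x: "x \<in> X" and orbx: "orb = orbit H ?a x"
      using orb by (auto simp: orbits_def)
    have orb_eq: "orb = (\<lambda>h. act h x) ` carrier H" using x orbx by (auto simp: orbit_def)
    show ?thesis
    proof (cases "\<exists>y\<in>orb. ?f y = 0")
      case True
      then obtain h where h: "h \<in> carrier H" "\<forall>g\<in>carrier H. act g (act h x) = act h x"
        by (auto simp: orb_eq split: if_splits)
      have "act h x = x" using h inv1(1)[OF h(1) x] by auto
      then have "orb = {x}" using h x one by (auto simp: orb_eq)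
      then show ?thesis using h \<open>act h x = x\<close> by auto
    next
      case False
      then have f1: "?f y = 1" if "y \<in> orb" for y using that by (auto split: if_splits)
      then have "(\<Sum>x\<in>orb. ?f x) = card orb" by simp
      moreover have "card orb dvd p ^ k"
        using orbit_stabilizer_theorem[OF x] H(2) orbx by (metis dvd_triv_left order_def)
      then obtain i where i: "card orb = p ^ i" using H(3) divides_primepow_nat by blast
      moreover have "i \<noteq> 0"
      proof
        assume "i = 0"
        then obtain y where "orb = {y}" using i card_1_singletonE by force
        moreover have "x \<in> orb" using orbit_refl[OF x] orbx by simp
        moreover obtain h where "h \<in> carrier H" "act h x \<noteq> x" using f1[OF \<open>x \<in> orb\<close>] by (metis zero_neq_one)
        moreover then have "act h x \<in> orb" by (auto simp: orb_eq)
        ultimately show False by auto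
      qed
      ultimately show ?thesis by auto
    qed
  qed
  then have "p dvd (\<Sum>orb\<in>orbits H X ?a. \<Sum>x\<in>orb. ?f x)" by (rule dvd_sum)
  also have "\<dots> = (\<Sum>x\<in>X. ?f x)" by (rule disjoint_sum[OF X])
  also have "\<dots> = card {x \<in> X. \<exists>h \<in> carrier H. act h x \<noteq> x}"
    using X by (simp add: sum.If_cases Int_def)
  finally show ?thesis .
qed

text \<open>\<open>H\<close> acts on the right cosets of \<open>T\<close> by right multiplication
  with the inverse of \<open>\<theta> h\<close>. Their number is prime to \<open>p\<close>, so some
  coset \<open>Ta\<close> is fixed, which says that \<open>a\<close> conjugates the image of
  \<open>\<theta>\<close> into \<open>T\<close>. Stating it for a homomorphism covers the map from a
  normalizer in \<open>S\<close> to automorphisms.\<close>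

lemma sylow_conj_subset:
  assumes A: "group A" and T: "subgroup T A" "sylow_in p T (carrier A)"
    and H: "group H" "card (carrier H) = p ^ k" "prime p"
    and \<theta>: "\<theta> \<in> hom H A"
  shows "\<exists>a \<in> carrier A. \<forall>h \<in> carrier H. a \<otimes>\<^bsub>A\<^esub> \<theta> h \<otimes>\<^bsub>A\<^esub> inv\<^bsub>A\<^esub> a \<in> T"
proof -
  interpret A: group A by fact
  interpret H: group H by fact
  interpret \<theta>: group_hom H A \<theta> by unfold_locales fact
  let ?X = "rcosets\<^bsub>A\<^esub> T"
  let ?act = "\<lambda>h C. C #>\<^bsub>A\<^esub> inv\<^bsub>A\<^esub> (\<theta> h)"
  have fin: "finite (carrier A)" and cT: "card T = p ^ multiplicity p (card (carrier A))"
    using T(2) by (auto simp: sylow_in_def)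
  have lag: "card ?X * card T = card (carrier A)"
    using A.lagrange[OF T(1)] by (simp add: order_def)
  have "card (carrier A) \<noteq> 0" using fin A.one_closed by auto
  have np: "\<not> p dvd card ?X"
  proof
    assume "p dvd card ?X"
    then have "p ^ Suc (multiplicity p (card (carrier A))) dvd card (carrier A)"
      using lag cT by (metis dvd_refl mult_dvd_mono power_Suc)
    then show False
      using \<open>card (carrier A) \<noteq> 0\<close> H(3) by (metis not_prime_unit power_dvd_iff_le_multiplicity not_less_eq_eq order_refl)
  qed
  have finX: "finite ?X" using fin by (auto simp: RCOSETS_def)
  have sub: "T \<subseteq> carrier A" using T(1) by (rule subgroup.subset)
  have Xsub: "C \<subseteq> carrier A" if "C \<in> ?X" for C
    using that subgroup.rcosets_carrier[OF T(1) A] by blast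
  have "p dvd card {C \<in> ?X. \<exists>h \<in> carrier H. ?act h C \<noteq> C}"
  proof (rule p_dvd_card_nonfixed[OF H finX])
    fix h C assume "h \<in> carrier H" "C \<in> ?X"
    then show "?act h C \<in> ?X"
      by (auto simp: RCOSETS_def A.coset_mult_assoc sub)
  next
    fix C assume "C \<in> ?X"
    then show "?act \<one>\<^bsub>H\<^esub> C = C" using Xsub by simp
  next
    fix g h C assume "g \<in> carrier H" "h \<in> carrier H" "C \<in> ?X"
    then show "?act (g \<otimes>\<^bsub>H\<^esub> h) C = ?act g (?act h C)"
      using Xsub by (simp add: A.coset_mult_assoc A.inv_mult_group)
  qed
  then have "{C \<in> ?X. \<exists>h \<in> carrier H. ?act h C \<noteq> C} \<noteq> ?X" using np by auto
  then have "\<exists>C\<in>?X. \<forall>h\<in>carrier H. ?act h C = C" by blast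
  then obtain a where a: "a \<in> carrier A" and fix1: "\<forall>h\<in>carrier H. ?act h (T #>\<^bsub>A\<^esub> a) = T #>\<^bsub>A\<^esub> a"
    unfolding RCOSETS_def by blast
  have "a \<otimes>\<^bsub>A\<^esub> \<theta> h \<otimes>\<^bsub>A\<^esub> inv\<^bsub>A\<^esub> a \<in> T" if h: "h \<in> carrier H" for h
  proof -
    have "T #>\<^bsub>A\<^esub> (a \<otimes>\<^bsub>A\<^esub> \<theta> h) = T #>\<^bsub>A\<^esub> a"
      \<comment> \<open>Fixedness is used at the inverse of \<open>h\<close>, since the action
        itself carries an inverse.\<close>
      using fix1[rule_format, of "inv\<^bsub>H\<^esub> h"] h a sub by (simp add: A.coset_mult_assoc)
    then have "a \<otimes>\<^bsub>A\<^esub> \<theta> h \<in> T #>\<^bsub>A\<^esub> a"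
      using A.rcos_self[OF _ T(1), of "a \<otimes>\<^bsub>A\<^esub> \<theta> h"] a h by simp
    then show ?thesis using subgroup.rcos_module_imp[OF T(1) A a] by simp
  qed
  then show ?thesis using a by blast
qed

text \<open>One exponent \<open>m\<close> serves both parities. What matters is that
  \<open>p\<close> divides both \<open>m\<close> and \<open>m * (m - 1) div 2\<close>; for
  \<open>p = 2\<close> this is true of 4 but not of 2.\<close>

definition test_exponent :: "nat \<Rightarrow> nat" where
  "test_exponent p = (if p = 2 then 4 else p)"

lemma test_subgroup_iff:
  "test_subgroup p S A \<longleftrightarrow> subgroup A S \<and> (\<forall>x\<in>A. \<forall>y\<in>A. x \<otimes>\<^bsub>S\<^esub> y = y \<otimes>\<^bsub>S\<^esub> x) \<and>
     (\<forall>x\<in>A. x [^]\<^bsub>S\<^esub> test_exponent p = \<one>\<^bsub>S\<^esub>)"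
  by (simp add: test_subgroup_def test_exponent_def abelian_exp_le_4_def elementary_abelian_def)

locale finite_p_group = group S for S (structure) +
  fixes p :: nat
  assumes prime_p: "prime p" and fin: "finite (carrier S)"
    and card_S: "\<exists>n. card (carrier S) = p ^ n"
begin

section \<open>Fixed cosets, growing normalizers, powers in class two\<close>

lemma cancel:
  "x \<in> carrier S \<Longrightarrow> y \<in> carrier S \<Longrightarrow> inv x \<otimes> (x \<otimes> y) = y"
  "x \<in> carrier S \<Longrightarrow> y \<in> carrier S \<Longrightarrow> x \<otimes> (inv x \<otimes> y) = y"
  by (simp_all flip: m_assoc)

lemmas word_simps = m_assoc inv_mult_group cancel

lemma card_subgroup: "subgroup H S \<Longrightarrow> \<exists>n. card H = p ^ n"
  using card_S prime_p lagrange[of H] by (metis divides_primepow_nat dvd_triv_right order_def)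

lemma finite_subgroup: "subgroup H S \<Longrightarrow> finite H"
  using fin finite_subset subgroup.subset by blast

text \<open>\<open>R\<close> acts by conjugation on the cosets of \<open>X\<close> in
  \<open>N\<close>, whose number is a nontrivial power of \<open>p\<close>. So the number of fixed
  cosets is divisible by \<open>p\<close>, and as \<open>X\<close> itself is fixed there is a second
  one. \<open>R\<close> may be \<open>X\<close> itself or a group containing \<open>N\<close>; both
  uses occur below.\<close>

lemma exists_central_mod:
  assumes R: "subgroup R S" and X: "subgroup X S" and N: "subgroup N S" and XN: "X \<subset> N"
    and RX: "\<And>r x. r \<in> R \<Longrightarrow> x \<in> X \<Longrightarrow> r \<otimes> x \<otimes> inv r \<in> X"
    and RN: "\<And>r x. r \<in> R \<Longrightarrow> x \<in> N \<Longrightarrow> r \<otimes> x \<otimes> inv r \<in> N"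
  shows "\<exists>n \<in> N - X. \<forall>r\<in>R. r \<otimes> n \<otimes> inv r \<otimes> inv n \<in> X"
proof -
  let ?N = "S\<lparr>carrier := N\<rparr>" and ?R = "S\<lparr>carrier := R\<rparr>"
  have gN: "group ?N" and gR: "group ?R" using N R by (auto intro: subgroup.subgroup_is_group)
  have XN': "subgroup X ?N" using subgroup_incl[OF X N] XN by blast
  let ?X = "rcosets\<^bsub>?N\<^esub> X"
  let ?act = "\<lambda>r C. (\<lambda>x. r \<otimes> x \<otimes> inv r) ` C"
  have Ss [simp]: "x \<in> carrier S" if "x \<in> R \<or> x \<in> N \<or> x \<in> X" for x
    using that subgroup.mem_carrier R N X by metis
  have lag: "card ?X * card X = card N"
    using group.lagrange[OF gN XN'] by (simp add: order_def)
  obtain i j where ij: "card X = p ^ i" "card N = p ^ j" using card_subgroup X N by meson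
  have "card X < card N" using XN finite_subgroup[OF N] by (simp add: psubset_card_mono)
  then have "card ?X \<noteq> 1" using lag by auto
  moreover have "card ?X dvd p ^ j" using lag ij by (metis dvd_triv_left)
  ultimately have pd: "p dvd card ?X"
    using prime_p by (metis divides_primepow_nat dvd_power gr0I power_0)
  have finX: "finite ?X" using finite_subgroup[OF N] by (auto simp: RCOSETS_def)
  have act: "?act r (X #> n) = X #> (r \<otimes> n \<otimes> inv r)" if r: "r \<in> R" and n: "n \<in> N" for r n
  proof
    show "?act r (X #> n) \<subseteq> X #> (r \<otimes> n \<otimes> inv r)"
    proof
      fix y assume "y \<in> ?act r (X #> n)"
      then obtain x where x: "x \<in> X" "y = r \<otimes> (x \<otimes> n) \<otimes> inv r" by (auto simp: r_coset_def)
      have "y = (r \<otimes> x \<otimes> inv r) \<otimes> (r \<otimes> n \<otimes> inv r)"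
        using x r n by (simp add: word_simps)
      then show "y \<in> X #> (r \<otimes> n \<otimes> inv r)" using RX[OF r x(1)] by (auto simp: r_coset_def)
    qed
    show "X #> (r \<otimes> n \<otimes> inv r) \<subseteq> ?act r (X #> n)"
    proof
      fix y assume "y \<in> X #> (r \<otimes> n \<otimes> inv r)"
      then obtain x where x: "x \<in> X" "y = x \<otimes> (r \<otimes> n \<otimes> inv r)" by (auto simp: r_coset_def)
      have ir: "inv r \<in> R" using R r by (simp add: subgroup.m_inv_closed)
      then have x': "inv r \<otimes> x \<otimes> r \<in> X" using RX[OF ir x(1)] r by simp
      have "y = r \<otimes> ((inv r \<otimes> x \<otimes> r) \<otimes> n) \<otimes> inv r"
        using x r n by (simp add: word_simps)
      then show "y \<in> ?act r (X #> n)" using x' by (auto simp: r_coset_def)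
    qed
  qed
  have cos: "C \<in> ?X \<longleftrightarrow> (\<exists>n\<in>N. C = X #> n)" for C by (auto simp: RCOSETS_def)
  obtain k where k: "card R = p ^ k" using card_subgroup R by blast
  define F where "F = {C \<in> ?X. \<exists>h \<in> carrier ?R. ?act h C \<noteq> C}"
  have pF: "p dvd card F" unfolding F_def
  proof (rule p_dvd_card_nonfixed[OF gR _ prime_p finX])
    show "card (carrier ?R) = p ^ k" using k by simp
  next
    fix r C assume "r \<in> carrier ?R" "C \<in> ?X"
    then show "?act r C \<in> ?X" unfolding cos using act RN by simp blast
  next
    fix C assume "C \<in> ?X"
    then show "?act \<one>\<^bsub>?R\<^esub> C = C" using act[of \<one>] subgroup.one_closed[OF R] by (auto simp: cos)
  next
    fix g h C assume gh: "g \<in> carrier ?R" "h \<in> carrier ?R" and "C \<in> ?X"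
    then obtain n where n: "n \<in> N" "C = X #> n" by (auto simp: cos)
    have "g \<otimes> h \<in> R" using gh R by (simp add: subgroup.m_closed)
    then have "?act (g \<otimes> h) C = X #> (g \<otimes> h \<otimes> n \<otimes> inv (g \<otimes> h))"
      using act n by simp
    also have "\<dots> = X #> (g \<otimes> (h \<otimes> n \<otimes> inv h) \<otimes> inv g)"
      using gh n by (simp add: word_simps)
    also have "\<dots> = ?act g (?act h C)" using act[of h n] act[of g "h \<otimes> n \<otimes> inv h"] RN[of h n] gh n by simp
    finally show "?act (g \<otimes>\<^bsub>?R\<^esub> h) C = ?act g (?act h C)" by simp
  qed
  have "F \<subseteq> ?X" by (auto simp: F_def)
  then have "card (?X - F) = card ?X - card F" using finX by (simp add: card_Diff_subset finite_subset)
  then have "p dvd card (?X - F)" using pd pF by (simp add: dvd_diff_nat)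
  moreover have XF: "X \<in> ?X - F"
  proof -
    have "X = X #> \<one>" using X by (simp add: subgroup.subset)
    moreover have "\<one> \<in> N" using N by (rule subgroup.one_closed)
    ultimately show ?thesis using act[of _ \<one>] by (auto simp: cos F_def)
  qed
  moreover have "finite (?X - F)" using finX by simp
  ultimately have "?X - F \<noteq> {X}" using prime_p by (auto dest: prime_gt_1_nat)
  then obtain C where C: "C \<in> ?X - F" "C \<noteq> X" using XF by blast
  then obtain n where n: "n \<in> N" "C = X #> n" by (auto simp: cos)
  have "n \<notin> X" using C(2) n X by (auto simp: coset_join2)
  moreover have "r \<otimes> n \<otimes> inv r \<otimes> inv n \<in> X" if r: "r \<in> R" for r
  proof -
    have "X #> (r \<otimes> n \<otimes> inv r) = X #> n" using C(1) n act[OF r n(1)] r by (auto simp: F_def)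
    then have "r \<otimes> n \<otimes> inv r \<in> X #> n"
      using rcos_self[OF _ X, of "r \<otimes> n \<otimes> inv r"] n r by simp
    then show ?thesis using subgroup.rcos_module_imp[OF X is_group] n by simp
  qed
  ultimately show ?thesis using n by blast
qed

lemma conj_closed:
  "subgroup H S \<Longrightarrow> g \<in> H \<Longrightarrow> x \<in> H \<Longrightarrow> g \<otimes> x \<otimes> inv g \<in> H"
  by (simp add: subgroup.m_closed subgroup.m_inv_closed)

text \<open>\<open>H\<close> acts on its own cosets in \<open>K\<close>; a fixed coset other than
  \<open>H\<close> consists of elements normalizing \<open>H\<close>.\<close>

lemma normalizers_grow:
  assumes H: "subgroup H S" and K: "subgroup K S" and HK: "H \<subset> K"
  shows "\<exists>g \<in> K - H. \<forall>x\<in>H. g \<otimes> x \<otimes> inv g \<in> H"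
proof -
  have Hc: "x \<in> carrier S" if "x \<in> H" for x using that H by (rule subgroup.mem_carrier[rotated])
  have Kc: "x \<in> carrier S" if "x \<in> K" for x using that K by (rule subgroup.mem_carrier[rotated])
  obtain n where n: "n \<in> K - H" "\<forall>r\<in>H. r \<otimes> n \<otimes> inv r \<otimes> inv n \<in> H"
    using exists_central_mod[OF H H K HK, OF conj_closed[OF H] conj_closed[OF K]] HK by blast
  have "n \<otimes> x \<otimes> inv n \<in> H" if x: "x \<in> H" for x
  proof -
    have "inv x \<otimes> n \<otimes> x \<otimes> inv n \<in> H"
      using n(2) subgroup.m_inv_closed[OF H x] Hc[OF x] by force
    then have "x \<otimes> (inv x \<otimes> n \<otimes> x \<otimes> inv n) \<in> H" using x H by (simp add: subgroup.m_closed)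
    then show ?thesis using Hc[OF x] Kc[of n] n(1) by (simp add: m_assoc[symmetric])
  qed
  then show ?thesis using n by blast
qed

text \<open>When the commutator \<open>z\<close> of \<open>b\<close> and \<open>a\<close> commutes
  with both, (ab)^m is a^m b^m times z to the power m(m-1)/2. Since \<open>b\<close> commutes with
  a^p, also z^p = 1, and this factor vanishes.\<close>

lemma power_mult_class2:
  assumes ab: "a \<in> carrier S" "b \<in> carrier S" "z \<in> carrier S"
    and ba: "b \<otimes> a = z \<otimes> a \<otimes> b" and za: "z \<otimes> a = a \<otimes> z" and zb: "z \<otimes> b = b \<otimes> z"
    and bap: "b \<otimes> a [^] p = a [^] p \<otimes> b" and m: "p dvd m * (m - 1) div 2"
  shows "(a \<otimes> b) [^] m = a [^] m \<otimes> b [^] (m::nat)"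
proof -
  have zA: "z [^] (i::nat) \<otimes> a = a \<otimes> z [^] i" for i
    using ab za by (simp add: group_commutes_pow)
  have bma: "b [^] (i::nat) \<otimes> a = z [^] i \<otimes> a \<otimes> b [^] i" for i
  proof (induction i)
    case (Suc i)
    have "b [^] Suc i \<otimes> a = b [^] i \<otimes> (b \<otimes> a)" using ab by (simp add: m_assoc)
    also have "\<dots> = b [^] i \<otimes> (a \<otimes> (b \<otimes> z))" using ab by (simp add: ba za zb m_assoc)
    also have "\<dots> = (b [^] i \<otimes> a) \<otimes> (b \<otimes> z)" using ab by (simp add: m_assoc)
    also have "\<dots> = z [^] i \<otimes> a \<otimes> (b [^] i \<otimes> b \<otimes> z)" using ab by (simp add: Suc m_assoc)
    also have "b [^] i \<otimes> b \<otimes> z = z \<otimes> b [^] Suc i"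
      using group_commutes_pow[OF zb[symmetric] ab(2,3), of "Suc i"] by simp
    also have "z [^] i \<otimes> a \<otimes> (z \<otimes> b [^] Suc i) = z [^] i \<otimes> (a \<otimes> z) \<otimes> b [^] Suc i"
      using ab by (simp add: m_assoc)
    also have "\<dots> = z [^] Suc i \<otimes> a \<otimes> b [^] Suc i" using ab by (simp add: za[symmetric] m_assoc)
    finally show ?case .
  qed (use ab in simp)
  have bam: "b \<otimes> a [^] (i::nat) = z [^] i \<otimes> (a [^] i \<otimes> b)" for i
  proof (induction i)
    case (Suc i)
    have "b \<otimes> a [^] Suc i = (b \<otimes> a [^] i) \<otimes> a" using ab by (simp add: m_assoc)
    also have "\<dots> = z [^] i \<otimes> (a [^] i \<otimes> (b \<otimes> a))" using ab by (simp add: Suc m_assoc)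
    also have "\<dots> = z [^] i \<otimes> ((a [^] i \<otimes> z) \<otimes> (a \<otimes> b))" using ab by (simp add: ba m_assoc)
    also have "a [^] i \<otimes> z = z \<otimes> a [^] i" using group_commutes_pow[OF za[symmetric]] ab by simp
    finally show ?case using ab by (simp add: m_assoc)
  qed (use ab in simp)
  have zp: "z [^] p = \<one>"
  proof -
    have "z [^] p \<otimes> (a [^] p \<otimes> b) = a [^] p \<otimes> b" using bam[of p] bap by simp
    then show ?thesis using ab by simp
  qed
  have "(a \<otimes> b) [^] i = z [^] (i * (i - 1) div 2) \<otimes> (a [^] i \<otimes> b [^] i)" for i :: nat
  proof (induction i)
    case (Suc i)
    let ?t = "i * (i - 1) div 2"
    have t: "Suc i * (Suc i - 1) div 2 = ?t + i"
      by (cases i) (auto simp: algebra_simps)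
    have zai: "z [^] i \<otimes> a [^] i = a [^] i \<otimes> z [^] i"
      using group_commutes_pow[OF zA[symmetric] ab(1), of i i] ab by simp
    have "(a \<otimes> b) [^] Suc i = z [^] ?t \<otimes> (a [^] i \<otimes> b [^] i) \<otimes> (a \<otimes> b)"
      by (simp add: Suc)
    also have "\<dots> = z [^] ?t \<otimes> a [^] i \<otimes> (b [^] i \<otimes> a) \<otimes> b" using ab by (simp add: m_assoc)
    also have "\<dots> = z [^] ?t \<otimes> (a [^] i \<otimes> z [^] i) \<otimes> a \<otimes> (b [^] i \<otimes> b)"
      using ab by (simp add: bma m_assoc)
    also have "\<dots> = (z [^] ?t \<otimes> z [^] i) \<otimes> (a [^] Suc i \<otimes> b [^] Suc i)"
      using ab by (simp add: zai[symmetric] m_assoc)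
    finally show ?case using ab t by (simp add: nat_pow_mult)
  qed (use ab in simp)
  moreover have "z [^] (m * (m - 1) div 2) = \<one>"
    using m zp ab by (metis dvdE nat_pow_one nat_pow_pow)
  ultimately show ?thesis using ab by simp
qed

lemma p_dvd_test_exponent: "p dvd test_exponent p"
  by (simp add: test_exponent_def)

lemma p_dvd_test_exponent_choose_2: "p dvd test_exponent p * (test_exponent p - 1) div 2"
proof (cases "p = 2")
  case False
  then have "even (p - 1)" using prime_p prime_odd_nat[of p] prime_ge_2_nat[of p] by simp
  then show ?thesis using False by (metis dvd_triv_left div_mult_swap test_exponent_def)
qed (simp add: test_exponent_def)

section \<open>Normalizers and adjoining an element\<close>

text \<open>The normalizer is the stabilizer of the set \<open>X\<close> under conjugation, hence
  defined by an equality of sets; as \<open>X\<close> is finite, an inclusion is enough.\<close>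

lemma normalizer_iff:
  assumes X: "subgroup X S"
  shows "g \<in> normalizer S X \<longleftrightarrow> g \<in> carrier S \<and> (\<forall>x\<in>X. g \<otimes> x \<otimes> inv g \<in> X)"
proof -
  have sub: "X \<subseteq> carrier S" using X by (rule subgroup.subset)
  have eq: "g <# X #> inv g = (\<lambda>x. g \<otimes> x \<otimes> inv g) ` X" by (auto simp: l_coset_def r_coset_def)
  have "(\<lambda>x. g \<otimes> x \<otimes> inv g) ` X = X"
    if g: "g \<in> carrier S" "\<forall>x\<in>X. g \<otimes> x \<otimes> inv g \<in> X"
  proof (rule endo_inj_surj)
    show "finite X" using X by (rule finite_subgroup)
    show "(\<lambda>x. g \<otimes> x \<otimes> inv g) ` X \<subseteq> X" using g by auto
    show "inj_on (\<lambda>x. g \<otimes> x \<otimes> inv g) X" 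
      
      by (rule inj_onI) (rule conjugation_is_inj[OF g(1)], use sub in auto)
  qed
  then show ?thesis using sub by (auto simp: normalizer_def stabilizer_def eq)
qed

lemma subgroup_normalizer: "subgroup X S \<Longrightarrow> subgroup (normalizer S X) S"
  using normalizer_imp_subgroup subgroup.subset by blast

lemma normalizer_self: "subgroup X S \<Longrightarrow> X \<subseteq> normalizer S X"
  using subgroup.mem_carrier by (fastforce simp: normalizer_iff conj_closed)

lemma normalizer_conj:
  assumes "subgroup X S" "g \<in> normalizer S X" "x \<in> X"
  shows "g \<otimes> x \<otimes> inv g \<in> X" "inv g \<otimes> x \<otimes> g \<in> X"
  using assms subgroup.m_inv_closed[OF subgroup_normalizer[OF assms(1)] assms(2)]
  by (auto simp: normalizer_iff)

lemma conj_int_pow: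
  assumes "g \<in> carrier S" "x \<in> carrier S"
  shows "g \<otimes> x [^] (i::int) \<otimes> inv g = (g \<otimes> x \<otimes> inv g) [^] i"
proof -
  have "(\<lambda>x. g \<otimes> x \<otimes> inv g) \<in> hom S S" using assms(1) by (auto simp: hom_def word_simps)
  from hom_int_pow[OF this _ is_group is_group] assms(2) show ?thesis by simp
qed

lemma conj_nat_pow:
  assumes "g \<in> carrier S" "x \<in> carrier S"
  shows "g \<otimes> x [^] (i::nat) \<otimes> inv g = (g \<otimes> x \<otimes> inv g) [^] i"
  using conj_int_pow[OF assms, of "int i"] by (simp add: int_pow_int)

text \<open>If \<open>n\<close> normalizes \<open>X\<close>, this is the subgroup generated by
  \<open>n\<close> and \<open>X\<close>. The explicit product with an integer exponent lets
  membership be unpacked directly.\<close>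

definition adjoin :: "'a \<Rightarrow> 'a set \<Rightarrow> 'a set" where
  "adjoin n X = {n [^] (i::int) \<otimes> x | i x. x \<in> X}"

lemma adjoinI: "x \<in> X \<Longrightarrow> n [^] (i::int) \<otimes> x \<in> adjoin n X"
  unfolding adjoin_def by blast

lemma subgroup_adjoin:
  assumes X: "subgroup X S" and n: "n \<in> normalizer S X"
  shows "subgroup (adjoin n X) S"
proof
  have nc: "n \<in> carrier S" using n X by (simp add: normalizer_iff)
  have Xc: "x \<in> carrier S" if "x \<in> X" for x using that X by (rule subgroup.mem_carrier[rotated])
  have ni: "n [^] (i::int) \<in> normalizer S X" for i
    by (rule subgroup_int_pow_closed[OF subgroup_normalizer[OF X] n])
  show "adjoin n X \<subseteq> carrier S" using nc Xc by (auto simp: adjoin_def)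
  show "\<one> \<in> adjoin n X" using adjoinI[OF subgroup.one_closed[OF X], of n 0] by simp
  show "a \<otimes> b \<in> adjoin n X" if ab: "a \<in> adjoin n X" "b \<in> adjoin n X" for a b
  proof -
    obtain i x j y where e: "a = n [^] (i::int) \<otimes> x" "b = n [^] (j::int) \<otimes> y" "x \<in> X" "y \<in> X"
      using ab by (auto simp: adjoin_def)
    have "a \<otimes> b = n [^] (i + j) \<otimes> ((inv (n [^] j) \<otimes> x \<otimes> n [^] j) \<otimes> y)"
      using e nc Xc by (simp add: word_simps int_pow_mult)
    then show ?thesis
      using adjoinI[OF subgroup.m_closed[OF X normalizer_conj(2)[OF X ni e(3)] e(4)]] by simp
  qed
  show "inv a \<in> adjoin n X" if a: "a \<in> adjoin n X" for a
  proof -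
    obtain i x where e: "a = n [^] (i::int) \<otimes> x" "x \<in> X" using a by (auto simp: adjoin_def)
    have "inv a = n [^] (- i) \<otimes> (n [^] i \<otimes> inv x \<otimes> inv (n [^] i))"
      using e nc Xc by (simp add: word_simps int_pow_neg)
    then show ?thesis
      using adjoinI[OF normalizer_conj(1)[OF X ni subgroup.m_inv_closed[OF X e(2)]]] by simp
  qed
qed

lemma adjoin_contains:
  assumes "subgroup X S" "n \<in> carrier S"
  shows "n \<in> adjoin n X" "X \<subseteq> adjoin n X"
proof -
  show "n \<in> adjoin n X"
    using adjoinI[OF subgroup.one_closed[OF assms(1)], of n 1] assms(2) by simp
  show "X \<subseteq> adjoin n X"
    using adjoinI[of _ X n 0] subgroup.mem_carrier[OF assms(1)] by fastforce
qed

lemma adjoin_subset: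
  assumes "subgroup Y S" "n \<in> Y" "X \<subseteq> Y"
  shows "adjoin n X \<subseteq> Y"
  using assms subgroup_int_pow_closed[OF assms(1,2)] by (auto simp: adjoin_def subgroup.m_closed)

section \<open>Maximal invariant subgroups\<close>

lemma subgroup_mem_of_coprime_pow:
  assumes X: "subgroup X S" and n: "n \<in> carrier S"
    and i: "n [^] (i::int) \<in> X" and j: "n [^] (j::int) \<in> X" and "coprime i j"
  shows "n \<in> X"
proof -
  obtain u v where "u * i + v * j = 1" using \<open>coprime i j\<close> by (metis bezout_int coprime_imp_gcd_eq_1)
  then have "n = n [^] (u * i + v * j)" using n by simp
  also have "\<dots> = (n [^] i) [^] u \<otimes> (n [^] j) [^] v"
    using n by (simp add: int_pow_mult int_pow_pow mult.commute)
  also have "\<dots> \<in> X" using X i j by (simp add: subgroup.m_closed subgroup_int_pow_closed)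
  finally show ?thesis .
qed

text \<open>Every maximal \<open>R\<close>-invariant proper subgroup of \<open>N\<close> containing \<open>E\<close> has these properties.\<close>
lemma exists_maximal_invariant:
  assumes R: "subgroup R S" and E: "subgroup E S" and N: "subgroup N S" and EN: "E \<subset> N" and NR: "N \<subseteq> R"
    and RE: "R \<subseteq> normalizer S E" and RN: "R \<subseteq> normalizer S N"
  obtains X where "subgroup X S" "E \<subseteq> X" "X \<subset> N" "R \<subseteq> normalizer S X"
    "\<And>r n. r \<in> R \<Longrightarrow> n \<in> N \<Longrightarrow> r \<otimes> n \<otimes> inv r \<otimes> inv n \<in> X"
    "\<And>n. n \<in> N \<Longrightarrow> n [^] p \<in> X"
proof -
  let ?C = "{X. subgroup X S \<and> E \<subseteq> X \<and> X \<subset> N \<and> R \<subseteq> normalizer S X}"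
  have "finite ?C" by (rule finite_subset[of _ "Pow N"]) (auto simp: finite_subgroup[OF N])
  moreover have "E \<in> ?C" using assms by auto
  ultimately obtain X where XC: "X \<in> ?C" and mx: "\<And>Y. Y \<in> ?C \<Longrightarrow> X \<subseteq> Y \<Longrightarrow> Y = X"
    using finite_has_maximal2[of ?C E] by (metis (no_types, lifting))
  then have X: "subgroup X S" "E \<subseteq> X" "X \<subset> N" "R \<subseteq> normalizer S X" by auto
  have max: "Y = N" if "subgroup Y S" "X \<subset> Y" "Y \<subseteq> N" "R \<subseteq> normalizer S Y" for Y
    using mx[of Y] that X by blast
  have c: "x \<in> carrier S" if "x \<in> R \<or> x \<in> N \<or> x \<in> X" for x
    using that R N X subgroup.mem_carrier by metis
  have Rinv: "inv r \<in> R" if "r \<in> R" for r using that R by (simp add: subgroup.m_inv_closed)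
  note nX = normalizer_conj[OF X(1) subsetD[OF X(4)]] and nN = normalizer_conj[OF N subsetD[OF RN]]
  \<comment> \<open>\<open>Y\<close> is the preimage of the elements of N/X centralized by
    \<open>R\<close>. It is \<open>R\<close>-invariant, and strictly larger than \<open>X\<close> by
    \<open>exists_central_mod\<close>, so by maximality it is all of \<open>N\<close>.\<close>
  define Y where "Y = {n \<in> N. \<forall>r\<in>R. r \<otimes> n \<otimes> inv r \<otimes> inv n \<in> X}"
  have sY: "subgroup Y S"
  proof
    show "Y \<subseteq> carrier S" using c by (auto simp: Y_def)
    show "\<one> \<in> Y" using N X(1) c by (auto simp: Y_def subgroup.one_closed)
    show "a \<otimes> b \<in> Y" if ab: "a \<in> Y" "b \<in> Y" for a b
    proof -
      have "r \<otimes> (a \<otimes> b) \<otimes> inv r \<otimes> inv (a \<otimes> b) \<in> X" if r: "r \<in> R" for r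
      proof -
        have "r \<otimes> (a \<otimes> b) \<otimes> inv r \<otimes> inv (a \<otimes> b) =
          (r \<otimes> a \<otimes> inv r \<otimes> inv a) \<otimes> (a \<otimes> (r \<otimes> b \<otimes> inv r \<otimes> inv b) \<otimes> inv a)"
          using ab r c by (simp add: word_simps Y_def)
        also have "\<dots> \<in> X" using ab r nX(1)[of a] NR by (auto simp: Y_def subgroup.m_closed[OF X(1)])
        finally show ?thesis .
      qed
      then show ?thesis using ab N by (auto simp: Y_def subgroup.m_closed)
    qed
    show "inv a \<in> Y" if a: "a \<in> Y" for a
    proof -
      have "r \<otimes> inv a \<otimes> inv r \<otimes> inv (inv a) \<in> X" if r: "r \<in> R" for r
      proof -
        have "r \<otimes> inv a \<otimes> inv r \<otimes> inv (inv a) = inv (inv a \<otimes> (r \<otimes> a \<otimes> inv r \<otimes> inv a) \<otimes> a)"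
          using a r c by (simp add: word_simps Y_def)
        also have "\<dots> \<in> X" using a r nX(2)[of a] NR X(1) by (auto simp: Y_def subgroup.m_inv_closed)
        finally show ?thesis .
      qed
      then show ?thesis using a N by (auto simp: Y_def subgroup.m_inv_closed)
    qed
  qed
  have RY: "R \<subseteq> normalizer S Y"
  proof
    fix s assume s: "s \<in> R"
    have "s \<otimes> n \<otimes> inv s \<in> Y" if n: "n \<in> Y" for n
    proof -
      have "r \<otimes> (s \<otimes> n \<otimes> inv s) \<otimes> inv r \<otimes> inv (s \<otimes> n \<otimes> inv s) \<in> X" if r: "r \<in> R" for r
      proof -
        \<comment> \<open>Conjugation by \<open>s\<close> permutes \<open>R\<close>: the condition
          on the conjugate of \<open>n\<close> at \<open>r\<close> is the conjugate of the condition
          on \<open>n\<close> at \<open>t\<close>.\<close>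
        define t where "t = inv s \<otimes> r \<otimes> s"
        have t: "t \<in> R" using r s R Rinv by (simp add: t_def subgroup.m_closed)
        have "r \<otimes> (s \<otimes> n \<otimes> inv s) \<otimes> inv r \<otimes> inv (s \<otimes> n \<otimes> inv s) =
            s \<otimes> (t \<otimes> n \<otimes> inv t \<otimes> inv n) \<otimes> inv s"
          using n r s c by (simp add: word_simps Y_def t_def)
        also have "\<dots> \<in> X" using n t s nX(1) by (auto simp: Y_def)
        finally show ?thesis .
      qed
      then show ?thesis using n s nN(1) by (auto simp: Y_def)
    qed
    then show "s \<in> normalizer S Y" using s c by (simp add: normalizer_iff[OF sY])
  qed
  have "X \<subseteq> Y"
    using X(1,3) nX(1) subgroup.m_closed[OF X(1)] subgroup.m_inv_closed[OF X(1)] unfolding Y_def by blast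
  moreover obtain n where "n \<in> N - X" "\<forall>r\<in>R. r \<otimes> n \<otimes> inv r \<otimes> inv n \<in> X"
    using exists_central_mod[OF R X(1) N X(3)] nX(1) nN(1) by blast
  ultimately have "Y = N" using max[OF sY _ _ RY] by (auto simp: Y_def)
  then have com: "r \<otimes> n \<otimes> inv r \<otimes> inv n \<in> X" if "r \<in> R" "n \<in> N" for r n
    using that unfolding Y_def by blast
  have "n [^] p \<in> X" if n: "n \<in> N" for n
  proof -
    have nc: "n \<in> carrier S" and nnX: "n [^] p \<in> normalizer S X"
      using n c NR X(4) subgroup_int_pow_closed[OF subgroup_normalizer[OF X(1)], of n "int p"]
      by (auto simp: int_pow_int)
    \<comment> \<open>Any subgroup between \<open>X\<close> and \<open>N\<close> is
      \<open>R\<close>-invariant, since commutators with \<open>R\<close> lie in \<open>X\<close>;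
      so \<open>Z\<close> is \<open>X\<close> or \<open>N\<close>. If it is \<open>N\<close>, then
      \<open>n\<close> is a power of n^p times an element of \<open>X\<close>. Thus a power of
      \<open>n\<close> with exponent prime to \<open>p\<close> lies in \<open>X\<close>, and then so
      does \<open>n\<close>.\<close>
    define Z where "Z = adjoin (n [^] p) X"
    have sZ: "subgroup Z S" unfolding Z_def using X(1) nnX by (rule subgroup_adjoin)
    have npN: "n [^] p \<in> N" using subgroup_int_pow_closed[OF N n, of "int p"] by (simp add: int_pow_int)
    have XZ: "X \<subseteq> Z" "n [^] p \<in> Z" unfolding Z_def using adjoin_contains[OF X(1), of "n [^] p"] nc by auto
    have ZN: "Z \<subseteq> N" unfolding Z_def using adjoin_subset[OF N npN] X by blast
    have "R \<subseteq> normalizer S Z"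
    proof
      fix r assume r: "r \<in> R"
      have "r \<otimes> v \<otimes> inv r \<in> Z" if v: "v \<in> Z" for v
      proof -
        have "(r \<otimes> v \<otimes> inv r \<otimes> inv v) \<otimes> v \<in> Z"
          using com[OF r] v ZN XZ by (meson sZ subgroup.m_closed subsetD)
        then show ?thesis using r v ZN c by (auto simp: word_simps subset_iff)
      qed
      then show "r \<in> normalizer S Z" using r c by (simp add: normalizer_iff[OF sZ])
    qed
    then consider "Z = X" | "Z = N" using max[OF sZ _ ZN] XZ by blast
    then show ?thesis
    proof cases
      case 2
      then obtain i x where i: "n = (n [^] p) [^] (i::int) \<otimes> x" "x \<in> X"
        using n by (auto simp: Z_def adjoin_def)
      have npi: "(n [^] p) [^] i = n [^] (int p * i)"
        using nc by (simp add: int_pow_pow flip: int_pow_int)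
      have "n [^] (1 - int p * i) = inv (n [^] (int p * i)) \<otimes> n"
        using int_pow_mult[OF nc, of "- (int p * i)" 1] nc by (simp add: int_pow_neg)
      also have "\<dots> = inv (n [^] (int p * i)) \<otimes> (n [^] (int p * i) \<otimes> x)" using i npi by simp
      also have "\<dots> = x" using nc c i(2) by (simp add: cancel)
      finally have x: "n [^] (1 - int p * i) \<in> X" using i(2) by simp
      obtain k where "card (carrier S) = p ^ k" using card_S by blast
      then have "n [^] (int p ^ k) = \<one>"
        using pow_order_eq_1[OF nc] by (metis int_pow_int of_nat_power order_def)
      then have "n [^] (int p ^ k) \<in> X" using X(1) by (simp add: subgroup.one_closed)
      moreover have "coprime (1 - int p * i) (int p ^ k)"
      proof -
        have "coprime (1 - int p * i) (int p)"
        proof (rule coprimeI)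
          fix d assume "d dvd 1 - int p * i" "d dvd int p"
          then have "d dvd (1 - int p * i) + int p * i" by (meson dvd_add dvd_mult2)
          then show "is_unit d" by simp
        qed
        then show ?thesis by simp
      qed
      ultimately have "n \<in> X" using subgroup_mem_of_coprime_pow[OF X(1) nc x] by blast
      then show ?thesis using subgroup_int_pow_closed[OF X(1), of n "int p"] by (simp add: int_pow_int)
    qed (use XZ in auto)
  qed
  then show thesis using that X com by blast
qed

section \<open>Alperin's theorem on elements of small order\<close>

lemma nat_pow_subgroup: "subgroup H S \<Longrightarrow> x \<in> H \<Longrightarrow> x [^] (i::nat) \<in> H"
  using subgroup_int_pow_closed[of H x "int i"] by (simp add: int_pow_int)

lemma subgroup_commuting:
  assumes W: "subgroup W S" and V: "V \<subseteq> carrier S"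
  shows "subgroup {x \<in> W. \<forall>v\<in>V. x \<otimes> v = v \<otimes> x} S"
proof
  have Wc: "x \<in> carrier S" if "x \<in> W" for x using that W by (rule subgroup.mem_carrier[rotated])
  show "{x \<in> W. \<forall>v\<in>V. x \<otimes> v = v \<otimes> x} \<subseteq> carrier S" using Wc by auto
  show "\<one> \<in> {x \<in> W. \<forall>v\<in>V. x \<otimes> v = v \<otimes> x}" using W V by (auto simp: subgroup.one_closed subset_iff)
  show "a \<otimes> b \<in> {x \<in> W. \<forall>v\<in>V. x \<otimes> v = v \<otimes> x}"
    if ab: "a \<in> {x \<in> W. \<forall>v\<in>V. x \<otimes> v = v \<otimes> x}" "b \<in> {x \<in> W. \<forall>v\<in>V. x \<otimes> v = v \<otimes> x}" for a b
  proof -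
    have "a \<otimes> b \<otimes> v = v \<otimes> (a \<otimes> b)" if v: "v \<in> V" for v
    proof -
      have "v \<in> carrier S" using v V by blast
      moreover have "a \<in> carrier S" "b \<in> carrier S" "a \<otimes> v = v \<otimes> a" "b \<otimes> v = v \<otimes> b"
        using ab v Wc by auto
      ultimately show ?thesis by (metis m_assoc)
    qed
    then show ?thesis using ab W by (simp add: subgroup.m_closed)
  qed
  show "inv a \<in> {x \<in> W. \<forall>v\<in>V. x \<otimes> v = v \<otimes> x}" if a: "a \<in> {x \<in> W. \<forall>v\<in>V. x \<otimes> v = v \<otimes> x}" for a
  proof -
    have "inv a \<otimes> v = v \<otimes> inv a" if v: "v \<in> V" for v
    proof -
      have vc: "v \<in> carrier S" and ac: "a \<in> carrier S" using v V a Wc by auto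
      have "inv a \<otimes> v = inv a \<otimes> (v \<otimes> a) \<otimes> inv a" using vc ac by (simp add: m_assoc)
      also have "v \<otimes> a = a \<otimes> v" using a v by simp
      also have "inv a \<otimes> (a \<otimes> v) \<otimes> inv a = v \<otimes> inv a" using vc ac by (simp add: word_simps)
      finally show ?thesis .
    qed
    then show ?thesis using a W by (simp add: subgroup.m_inv_closed)
  qed
qed

text \<open>Alperin's theorem. If \<open>g\<close> normalizes \<open>N\<^sub>R(\<langle>x\<rangle>E)\<close> but not \<open>\<langle>x\<rangle>E\<close>, then \<open>\<langle>x, gxg\<^sup>-\<^sup>1\<rangle>\<close> has
  class at most \<open>2\<close>, so the commutator of \<open>g\<close> and \<open>x\<close> again has small order, while it lies in a
  smaller \<open>R\<close>-invariant subgroup.\<close>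
lemma mem_maximal_normal_test_subgroup:
  assumes R: "subgroup R S" and PR: "P \<subseteq> R"
    and E: "test_subgroup p S E" "R \<subseteq> normalizer S E"
    and max: "\<And>L. test_subgroup p S L \<Longrightarrow> E \<subseteq> L \<Longrightarrow> L \<subseteq> P \<Longrightarrow> R \<subseteq> normalizer S L \<Longrightarrow> L = E"
  shows "subgroup N S \<Longrightarrow> E \<subseteq> N \<Longrightarrow> N \<subseteq> P \<Longrightarrow> R \<subseteq> normalizer S N \<Longrightarrow>
    (\<And>n e. n \<in> N \<Longrightarrow> e \<in> E \<Longrightarrow> n \<otimes> e = e \<otimes> n) \<Longrightarrow>
    x \<in> N \<Longrightarrow> x [^] test_exponent p = \<one> \<Longrightarrow> x \<in> E"
proof (induction "card N" arbitrary: N x rule: less_induct)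
  case less
  note N = less.prems(1) and EN = less.prems(2) and NP = less.prems(3) and RN = less.prems(4)
    and NE = less.prems(5) and xN = less.prems(6) and xm = less.prems(7)
  let ?m = "test_exponent p"
  have sE: "subgroup E S" using E(1) by (simp add: test_subgroup_iff)
  show ?case
  proof (rule ccontr)
    assume xE: "x \<notin> E"
    then have "E \<subset> N" using EN xN by blast
    moreover have NR: "N \<subseteq> R" using NP PR by blast
    \<comment> \<open>Commutators of \<open>R\<close> with \<open>N\<close> and p-th powers from
      \<open>N\<close> all fall into the smaller group \<open>X\<close>, to which the induction
      hypothesis applies.\<close>
    ultimately obtain X where X: "subgroup X S" "E \<subseteq> X" "X \<subset> N" "R \<subseteq> normalizer S X"
      and com: "\<And>r n. r \<in> R \<Longrightarrow> n \<in> N \<Longrightarrow> r \<otimes> n \<otimes> inv r \<otimes> inv n \<in> X"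
      and pow: "\<And>n. n \<in> N \<Longrightarrow> n [^] p \<in> X"
      using exists_maximal_invariant[OF R sE N _ _ E(2) RN] by metis
    have IH: "y \<in> E" if "y \<in> X" "y [^] ?m = \<one>" for y
      using less.hyps[of X y] X that NP NE finite_subgroup[OF N]
      by (meson psubset_card_mono psubset_imp_subset subset_trans subsetD)
    have c: "y \<in> carrier S" if "y \<in> R" for y using that R by (rule subgroup.mem_carrier[rotated])
    have ER: "E \<subseteq> R" using EN NR by blast
    have xR: "x \<in> R" using xN NR by blast
    have xc: "x \<in> carrier S" using xR c by blast
    have "(x [^] p) [^] ?m = (x [^] ?m) [^] p" using xc by (simp add: nat_pow_pow mult.commute)
    then have xp: "x [^] p \<in> E" using IH[OF pow[OF xN]] xm by simp
    have xnE: "x \<in> normalizer S E" using xR E(2) by blast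
    define L where "L = adjoin x E"
    have sL: "subgroup L S" unfolding L_def using sE xnE by (rule subgroup_adjoin)
    have xL: "x \<in> L" and EL: "E \<subseteq> L" unfolding L_def using adjoin_contains[OF sE xc] by auto
    have LN: "L \<subseteq> N" unfolding L_def using N xN EN by (rule adjoin_subset)
    \<comment> \<open>\<open>R\<close> already normalizes \<open>E\<close>, so only the conjugate of
      \<open>x\<close> has to be checked.\<close>
    have normL: "g \<in> normalizer S L" if g: "g \<in> R" "g \<otimes> x \<otimes> inv g \<in> L" for g
    proof -
      have "g \<otimes> l \<otimes> inv g \<in> L" if lL: "l \<in> L" for l
      proof -
        obtain i e where l: "l = x [^] (i::int) \<otimes> e" "e \<in> E" using lL by (auto simp: L_def adjoin_def)
        have ec: "e \<in> carrier S" using l ER c by blast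
        have "g \<otimes> l \<otimes> inv g = (g \<otimes> x [^] i \<otimes> inv g) \<otimes> (g \<otimes> e \<otimes> inv g)"
          using l g c ec xc by (simp add: word_simps)
        also have "\<dots> \<in> L"
          using subgroup_int_pow_closed[OF sL g(2)] conj_int_pow[OF c[OF g(1)] xc]
            normalizer_conj(1)[OF sE subsetD[OF E(2) g(1)] l(2)] EL
          by (metis sL subgroup.m_closed subsetD)
        finally show ?thesis .
      qed
      then show ?thesis using g c by (simp add: normalizer_iff[OF sL])
    qed
    define M where "M = R \<inter> normalizer S L"
    have sM: "subgroup M S" unfolding M_def using R subgroup_normalizer[OF sL] by (rule subgroups_Inter_pair)
    have MR: "M \<subseteq> R" by (auto simp: M_def)
    \<comment> \<open>If \<open>R\<close> normalized \<open>L\<close>, then \<open>L\<close>, which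
      is abelian of the right exponent because \<open>x\<close> centralizes \<open>E\<close>, would
      contradict the maximality of \<open>E\<close>.\<close>
    have "M \<noteq> R"
    proof
      assume "M = R"
      then have RL: "R \<subseteq> normalizer S L" by (auto simp: M_def)
      have cE: "a \<otimes> b = b \<otimes> a" if "a \<in> E" "b \<in> E" for a b using that E(1) by (simp add: test_subgroup_iff)
      have Ec: "E \<subseteq> carrier S" and Lc: "L \<subseteq> carrier S" using sE sL subgroup.subset by auto
      \<comment> \<open>Commutativity takes two rounds: first all of \<open>L\<close> commutes with
        \<open>x\<close> and \<open>E\<close>; so \<open>x\<close> and \<open>E\<close>, and
        therefore \<open>L\<close>, commute with all of \<open>L\<close>.\<close>
      have "L \<subseteq> {y \<in> carrier S. \<forall>v\<in>insert x E. y \<otimes> v = v \<otimes> y}" unfolding L_def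
        by (rule adjoin_subset[OF subgroup_commuting[OF subgroup_self]]) (use Ec xc cE NE[OF xN] in auto)
      then have "L \<subseteq> {y \<in> carrier S. \<forall>v\<in>L. y \<otimes> v = v \<otimes> y}"
        unfolding L_def
        by (intro adjoin_subset[OF subgroup_commuting[OF subgroup_self]]) (use Ec Lc xc L_def in auto)
      then have "a \<otimes> b = b \<otimes> a" if "a \<in> L" "b \<in> L" for a b using that by blast
      moreover have "l [^] ?m = \<one>" if lL: "l \<in> L" for l
      proof -
        obtain i e where l: "l = x [^] (i::int) \<otimes> e" "e \<in> E" using lL by (auto simp: L_def adjoin_def)
        have ec: "e \<in> carrier S" using l ER c by blast
        have "x [^] i \<in> L" "e \<in> L" using subgroup_int_pow_closed[OF sL xL] l EL by auto
        then have "x [^] i \<otimes> e = e \<otimes> x [^] i" by (rule calculation)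
        then have "l [^] ?m = (x [^] i) [^] ?m \<otimes> e [^] ?m"
          unfolding l(1) using ec xc by (intro pow_mult_distrib) auto
        also have "(x [^] i) [^] ?m = (x [^] ?m) [^] i"
          using xc by (simp add: int_pow_pow mult.commute flip: int_pow_int)
        finally show ?thesis using xm E(1) l by (simp add: test_subgroup_iff)
      qed
      ultimately have "test_subgroup p S L" using sL by (simp add: test_subgroup_iff)
      then have "L = E" using max EL LN NP RL by blast
      then show False using xL xE by blast
    qed
    then obtain g where g: "g \<in> R - M" "\<forall>h\<in>M. g \<otimes> h \<otimes> inv g \<in> M"
      using normalizers_grow[OF sM R] MR by blast
    then have gM: "g \<in> normalizer S M" using c by (simp add: normalizer_iff[OF sM])
    have gR: "g \<in> R" and gc: "g \<in> carrier S" using g c by auto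
    have gL: "g \<notin> normalizer S L" using g by (auto simp: M_def)
    have "x \<otimes> x \<otimes> inv x \<in> L" using xL xc by (simp add: m_assoc)
    then have xM: "x \<in> M" using normL[OF xR] xR by (auto simp: M_def)
    \<comment> \<open>\<open>a \<otimes> b\<close> is the commutator of \<open>g\<close> and
      \<open>x\<close>, which lies in \<open>X\<close>. As \<open>g\<close> normalizes
      \<open>M\<close>, the two conjugates \<open>a\<close> and \<open>x'\<close> of
      \<open>x\<close> normalize \<open>L\<close>.\<close>
    define a where "a = g \<otimes> x \<otimes> inv g"
    define b where "b = inv x"
    define x' where "x' = inv g \<otimes> x \<otimes> g"
    have aM: "a \<in> M" and x'M: "x' \<in> M"
      unfolding a_def x'_def using normalizer_conj[OF sM gM xM] by auto
    have aN: "a \<in> N" unfolding a_def using normalizer_conj(1)[OF N subsetD[OF RN gR] xN] .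
    have bN: "b \<in> N" unfolding b_def using N xN by (rule subgroup.m_inv_closed)
    have bL: "b \<in> L" unfolding b_def using sL xL by (rule subgroup.m_inv_closed)
    have ac: "a \<in> carrier S" and bc: "b \<in> carrier S" and x'c: "x' \<in> carrier S"
      using gc xc by (auto simp: a_def b_def x'_def)
    \<comment> \<open>\<open>z\<close> lies in \<open>L\<close> because \<open>a\<close> normalizes
      \<open>L\<close>, and \<open>inv g \<otimes> z \<otimes> g\<close> lies in \<open>L\<close>
      because \<open>x'\<close> does; so \<open>z\<close> is in \<open>L\<close> and in its
      conjugate by \<open>g\<close>.\<close>
    define z where "z = b \<otimes> a \<otimes> inv b \<otimes> inv a"
    have zL: "z \<in> L"
    proof -
      have "a \<otimes> x \<otimes> inv a \<in> L" using normalizer_conj(1)[OF sL _ xL] aM by (auto simp: M_def)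
      then have "b \<otimes> (a \<otimes> x \<otimes> inv a) \<in> L" using bL sL by (simp add: subgroup.m_closed)
      then show ?thesis using xc ac by (simp add: z_def b_def m_assoc)
    qed
    have zLg: "inv g \<otimes> z \<otimes> g \<in> L"
    proof -
      have "inv x' \<otimes> x \<otimes> x' \<in> L" using normalizer_conj(2)[OF sL _ xL] x'M by (auto simp: M_def)
      then have "(inv x' \<otimes> x \<otimes> x') \<otimes> inv x \<in> L" using bL sL by (simp add: b_def subgroup.m_closed)
      then show ?thesis using xc gc by (simp add: z_def b_def a_def x'_def word_simps)
    qed
    \<comment> \<open>Otherwise \<open>z\<close> is x^i times an element of \<open>E\<close>, with
      \<open>i\<close> prime to \<open>p\<close> because x^p is in \<open>E\<close>. Conjugating by
      \<open>inv g\<close> shows that y^i and y^p are in \<open>L\<close>, where \<open>y\<close> is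
      the conjugate of \<open>x\<close>. Hence \<open>y\<close> is in \<open>L\<close>, and
      \<open>g\<close> would normalize \<open>L\<close>.\<close>
    have zE: "z \<in> E"
    proof (rule ccontr)
      assume "z \<notin> E"
      obtain i e where l: "z = x [^] (i::int) \<otimes> e" "e \<in> E" using zL by (auto simp: L_def adjoin_def)
      have ec: "e \<in> carrier S" using l ER c by blast
      have ip: "\<not> int p dvd i"
      proof
        assume "int p dvd i"
        then obtain j where "i = int p * j" by auto
        then have "x [^] i = (x [^] p) [^] j" using xc by (simp add: int_pow_pow flip: int_pow_int)
        then have "x [^] i \<in> E" using subgroup_int_pow_closed[OF sE xp] by simp
        then show False using l \<open>z \<notin> E\<close> sE by (simp add: subgroup.m_closed)
      qed
      have ig: "inv g \<in> R" using gR R by (simp add: subgroup.m_inv_closed)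
      define y where "y = inv g \<otimes> x \<otimes> g"
      have yc: "y \<in> carrier S" using gc xc by (simp add: y_def)
      have yi: "y [^] (j::int) = inv g \<otimes> x [^] j \<otimes> g" for j
        using conj_int_pow[of "inv g" x j] gc xc by (simp add: y_def)
      have gE: "inv g \<otimes> f \<otimes> g \<in> L" if "f \<in> E" for f
        using normalizer_conj(2)[OF sE subsetD[OF E(2) gR] that] EL by blast
      have "y [^] i = (inv g \<otimes> z \<otimes> g) \<otimes> (inv g \<otimes> inv e \<otimes> g)"
        using l gc xc ec by (simp add: yi word_simps)
      then have "y [^] i \<in> L" using zLg gE[of "inv e"] l sE sL by (simp add: subgroup.m_closed subgroup.m_inv_closed)
      moreover have "y [^] int p \<in> L" using gE[OF xp] yi[of "int p"] by (simp add: int_pow_int)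
      moreover have "coprime i (int p)" using ip prime_p by (metis coprime_commute prime_imp_coprime prime_int_nat_transfer nat_int of_nat_0_le_iff)
      ultimately have "y \<in> L" using subgroup_mem_of_coprime_pow[OF sL yc] by blast
      then have "inv g \<in> normalizer S L" using normL[OF ig] gc by (simp add: y_def)
      then show False using gL gc subgroup.m_inv_closed[OF subgroup_normalizer[OF sL]] by fastforce
    qed
    have zc: "z \<in> carrier S" using ac bc by (simp add: z_def)
    \<comment> \<open>\<open>z\<close> and a^p lie in \<open>E\<close> and so commute with what the
      power formula requires. It gives \<open>a \<otimes> b\<close> small order, the induction
      hypothesis puts it into \<open>E\<close>, and then \<open>a\<close> is in \<open>L\<close>, so
      that \<open>g\<close> normalizes \<open>L\<close> after all.\<close>
    have "(a \<otimes> b) [^] ?m = a [^] ?m \<otimes> b [^] ?m"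
    proof (rule power_mult_class2[OF ac bc zc])
      show "b \<otimes> a = z \<otimes> a \<otimes> b" using ac bc by (simp add: z_def word_simps)
      show "z \<otimes> a = a \<otimes> z" "z \<otimes> b = b \<otimes> z" using NE[OF aN zE] NE[OF bN zE] by auto
      have "a [^] p = g \<otimes> x [^] p \<otimes> inv g" using conj_nat_pow[OF gc xc] by (simp add: a_def)
      then have "a [^] p \<in> E" using normalizer_conj(1)[OF sE subsetD[OF E(2) gR] xp] by simp
      then show "b \<otimes> a [^] p = a [^] p \<otimes> b" using NE[OF bN] by simp
      show "p dvd ?m * (?m - 1) div 2" by (rule p_dvd_test_exponent_choose_2)
    qed
    also have "a [^] ?m = \<one>" using conj_nat_pow[OF gc xc, of ?m] gc xm by (simp add: a_def)
    also have "b [^] ?m = \<one>" using nat_pow_inv[OF xc, of ?m] xm by (simp add: b_def)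
    finally have "(a \<otimes> b) [^] ?m = \<one>" by simp
    moreover have "a \<otimes> b \<in> X" using com[OF gR xN] by (simp add: a_def b_def)
    ultimately have "a \<otimes> b \<in> E" using IH by blast
    then have "(a \<otimes> b) \<otimes> x \<in> L" using EL xL sL by (meson subgroup.m_closed subsetD)
    then have "a \<in> L" using ac xc by (simp add: b_def m_assoc)
    then show False using normL[OF gR] gL by (simp add: a_def)
  qed
qed

section \<open>Automorphisms of order prime to \<open>p\<close>\<close>

text \<open>If \<open>k\<close> fixes y = w^-1 k(w), iteration gives k^i(w) = w y^i. At i = q this
  yields y^q = 1, and as the order of \<open>y\<close> is a power of \<open>p\<close>, y =
  1.\<close>

lemma fixes_if_fixes_commutator:
  assumes P: "subgroup P S"
    and k: "\<And>x. x \<in> P \<Longrightarrow> k x \<in> P" "\<And>x y. x \<in> P \<Longrightarrow> y \<in> P \<Longrightarrow> k (x \<otimes> y) = k x \<otimes> k y"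
    and kq: "\<And>x. x \<in> P \<Longrightarrow> (k ^^ q) x = x" and q: "coprime q p"
    and w: "w \<in> P" and y: "k (inv w \<otimes> k w) = inv w \<otimes> k w"
  shows "k w = w"
proof -
  have c: "x \<in> carrier S" if "x \<in> P" for x using that P by (rule subgroup.mem_carrier[rotated])
  define y where "y = inv w \<otimes> k w"
  have yP: "y \<in> P" using w k P by (simp add: y_def subgroup.m_closed subgroup.m_inv_closed)
  have kw: "k w = w \<otimes> y" using w k c by (simp add: y_def cancel)
  have ky: "k y = y" using y by (simp add: y_def)
  have yi: "y [^] (i::nat) \<in> P" for i using nat_pow_subgroup[OF P yP] .
  have k1: "k \<one> = \<one>"
  proof -
    have o: "\<one> \<in> P" using P by (rule subgroup.one_closed)
    then have "k \<one> \<otimes> k \<one> = k \<one>" using k(2)[OF o o] by simp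
    then show ?thesis using k(1)[OF o] c by simp
  qed
  have kyi: "k (y [^] (i::nat)) = y [^] i" for i
    by (induction i) (auto simp: k1 k(2) yi yP ky)
  have "(k ^^ i) w = w \<otimes> y [^] i" for i
  proof (induction i)
    case (Suc i)
    have "(k ^^ Suc i) w = k w \<otimes> y [^] i" using w yi by (simp add: Suc k(2) kyi)
    also have "\<dots> = w \<otimes> (y \<otimes> y [^] i)" using w yP c by (simp add: kw m_assoc)
    also have "y \<otimes> y [^] i = y [^] Suc i" using yP c by (simp only: nat_pow_Suc2)
    finally show ?case .
  qed (use w c in simp)
  then have "w \<otimes> y [^] q = w" using kq[OF w] by simp
  then have "y [^] q = \<one>" using w yP c by simp
  then have "y [^] int q = \<one>" by (simp add: int_pow_int)
  moreover obtain n where "card (carrier S) = p ^ n" using card_S by blast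
  then have "y [^] int (p ^ n) = \<one>" using pow_order_eq_1[OF c[OF yP]] unfolding int_pow_int by (simp add: order_def)
  moreover have "coprime (int q) (int (p ^ n))" using q by simp
  ultimately have "y \<in> {\<one>}"
    using subgroup_mem_of_coprime_pow[OF triv_subgroup c[OF yP], of "int q" "int (p ^ n)"] by simp
  then show ?thesis using kw w c by simp
qed

text \<open>First \<open>k\<close> is shown to be trivial on C_P(E). For \<open>x\<close> in
  \<open>P\<close> the commutator x^-1 k(x) lies in C_P(E), because \<open>P\<close> normalizes
  \<open>E\<close> and \<open>k\<close> fixes \<open>E\<close>; so
  \<open>fixes_if_fixes_commutator\<close> finishes the proof.\<close>

theorem coprime_automorphism_trivial:
  assumes R: "subgroup R S" and P: "subgroup P S" and PR: "P \<subseteq> R" and RP: "R \<subseteq> normalizer S P"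
    and E: "test_subgroup p S E" "R \<subseteq> normalizer S E" and EP: "E \<subseteq> P"
    and max: "\<And>L. test_subgroup p S L \<Longrightarrow> E \<subseteq> L \<Longrightarrow> L \<subseteq> P \<Longrightarrow> R \<subseteq> normalizer S L \<Longrightarrow> L = E"
    and k: "\<And>x. x \<in> P \<Longrightarrow> k x \<in> P" "\<And>x y. x \<in> P \<Longrightarrow> y \<in> P \<Longrightarrow> k (x \<otimes> y) = k x \<otimes> k y"
    and kq: "\<And>x. x \<in> P \<Longrightarrow> (k ^^ q) x = x" and q: "coprime q p"
    and kE: "\<And>x. x \<in> E \<Longrightarrow> k x = x"
    and x: "x \<in> P"
  shows "k x = x"
proof -
  have cof: "k w = w" if "w \<in> P" "k (inv w \<otimes> k w) = inv w \<otimes> k w" for w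
    using fixes_if_fixes_commutator[of P k q w] P k kq q that by blast
  have c: "x \<in> carrier S" if "x \<in> P" for x using that P by (rule subgroup.mem_carrier[rotated])
  have k1: "k \<one> = \<one>"
  proof -
    have o: "\<one> \<in> P" using P by (rule subgroup.one_closed)
    then have "k \<one> \<otimes> k \<one> = k \<one>" using k(2)[OF o o] by simp
    then show ?thesis using k(1)[OF o] c by simp
  qed
  have Pi: "inv x \<in> P" if "x \<in> P" for x using that P by (simp add: subgroup.m_inv_closed)
  have Pm: "x \<otimes> y \<in> P" if "x \<in> P" "y \<in> P" for x y using that P by (simp add: subgroup.m_closed)
  have kinv: "k (inv x) = inv (k x)" if x: "x \<in> P" for x
  proof -
    have "k x \<otimes> k (inv x) = \<one>" using k(2)[OF x Pi[OF x]] c[OF x] k1 by simp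
    then show ?thesis using k(1) x Pi c by (metis inv_equality inv_inv inv_closed)
  qed
  have kpow: "k (x [^] (i::nat)) = k x [^] i" if x: "x \<in> P" for x i
    by (induction i) (auto simp: k1 k(2) nat_pow_subgroup[OF P x] x)
  define C where "C = {x \<in> P. \<forall>e\<in>E. x \<otimes> e = e \<otimes> x}"
  have sE: "subgroup E S" using E(1) by (simp add: test_subgroup_iff)
  have cE: "e \<in> carrier S" if "e \<in> E" for e using that EP c by blast
  have sC: "subgroup C S" unfolding C_def using subgroup_commuting[OF P] cE by blast
  have CP: "C \<subseteq> P" by (auto simp: C_def)
  have CE: "n \<otimes> e = e \<otimes> n" if "n \<in> C" "e \<in> E" for n e using that by (simp add: C_def)
  have EC: "E \<subseteq> C" using EP E(1) by (auto simp: C_def test_subgroup_iff)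
  have RC: "R \<subseteq> normalizer S C"
  proof
    fix r assume r: "r \<in> R"
    then have rc: "r \<in> carrier S" using R by (rule subgroup.mem_carrier[rotated])
    have "r \<otimes> n \<otimes> inv r \<in> C" if n: "n \<in> C" for n
    proof -
      have nc: "n \<in> carrier S" using n CP c by blast
      have "(r \<otimes> n \<otimes> inv r) \<otimes> e = e \<otimes> (r \<otimes> n \<otimes> inv r)" if e: "e \<in> E" for e
      proof -
        have e': "inv r \<otimes> e \<otimes> r \<in> E" using normalizer_conj(2)[OF sE subsetD[OF E(2) r] e] .
        have "(r \<otimes> n \<otimes> inv r) \<otimes> e = r \<otimes> (n \<otimes> (inv r \<otimes> e \<otimes> r)) \<otimes> inv r"
          using rc nc cE[OF e] by (simp add: word_simps)
        also have "n \<otimes> (inv r \<otimes> e \<otimes> r) = (inv r \<otimes> e \<otimes> r) \<otimes> n" using CE[OF n e'] .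
        also have "r \<otimes> \<dots> \<otimes> inv r = e \<otimes> (r \<otimes> n \<otimes> inv r)"
          using rc nc cE[OF e] by (simp add: word_simps)
        finally show ?thesis .
      qed
      then show ?thesis using normalizer_conj(1)[OF P subsetD[OF RP r]] n by (auto simp: C_def)
    qed
    then show "r \<in> normalizer S C" using rc by (simp add: normalizer_iff[OF sC])
  qed
  have kC: "k x \<in> C" if x: "x \<in> C" for x
  proof -
    have "k x \<otimes> e = e \<otimes> k x" if e: "e \<in> E" for e
    proof -
      have "x \<in> P" "e \<in> P" using x e EP CP by auto
      then show ?thesis using k(2)[of x e] k(2)[of e x] CE[OF x e] kE[OF e] by metis
    qed
    then show ?thesis using x k(1) by (auto simp: C_def)
  qed
  \<comment> \<open>Alperin's theorem for \<open>N = C\<close>: elements of small order in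
    \<open>C\<close> lie in \<open>E\<close> and are therefore fixed by \<open>k\<close>.\<close>
  have small: "y \<in> E" if "y \<in> C" "y [^] test_exponent p = \<one>" for y
    using mem_maximal_normal_test_subgroup[of R P E C y] R PR E max sC EC CP RC CE that by blast
  have fixC: "k w = w" if "w \<in> C" for w
  proof (rule ccontr)
    assume "k w \<noteq> w"
    \<comment> \<open>On a minimal member \<open>W\<close>, every proper \<open>k\<close>-invariant
      subgroup is fixed pointwise.\<close>
    let ?\<W> = "{W. subgroup W S \<and> W \<subseteq> C \<and> k ` W \<subseteq> W \<and> (\<exists>w\<in>W. k w \<noteq> w)}"
    have "finite ?\<W>" by (rule finite_subset[of _ "Pow C"]) (auto simp: finite_subgroup[OF sC])
    moreover have "C \<in> ?\<W>" using sC kC that \<open>k w \<noteq> w\<close> by auto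
    ultimately obtain W where WC: "W \<in> ?\<W>" and mn: "\<And>V. V \<in> ?\<W> \<Longrightarrow> V \<subseteq> W \<Longrightarrow> V = W"
      using finite_has_minimal2[of ?\<W> C] by (metis (no_types, lifting))
    then obtain w where W: "subgroup W S" "W \<subseteq> C" "k ` W \<subseteq> W" and w: "w \<in> W" "k w \<noteq> w" by auto
    have fixed: "k v = v" if "subgroup V S" "V \<subset> W" "k ` V \<subseteq> V" "v \<in> V" for V v
      using mn[of V] that W by blast
    have WP: "W \<subseteq> P" using W CP by blast
    have Wc: "x \<in> carrier S" if "x \<in> W" for x using that WP c by blast
    have Wm: "x \<otimes> y \<in> W" if "x \<in> W" "y \<in> W" for x y using that W by (simp add: subgroup.m_closed)
    have Wi: "inv x \<in> W" if "x \<in> W" for x using that W by (simp add: subgroup.m_inv_closed)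
    have Wk: "k x \<in> W" if "x \<in> W" for x using that W by auto
    have "{\<one>} \<subset> W" using w k1 subgroup.one_closed[OF W(1)] by auto
    then obtain X where X: "subgroup X S" "X \<subset> W"
      and com: "\<And>r n. r \<in> W \<Longrightarrow> n \<in> W \<Longrightarrow> r \<otimes> n \<otimes> inv r \<otimes> inv n \<in> X"
      and pow: "\<And>n. n \<in> W \<Longrightarrow> n [^] p \<in> X"
      using exists_maximal_invariant[OF W(1) triv_subgroup W(1)] normalizer_self[OF W(1)] Wc
      by (metis (no_types, lifting) normalizer_iff[OF triv_subgroup] r_inv r_one singletonD singletonI subset_refl subsetI)
    \<comment> \<open>\<open>V\<close> is the Frattini subgroup of \<open>W\<close>. It is proper
      because it lies in \<open>X\<close>, and \<open>k\<close>-invariant because its generating set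
      is, so \<open>k\<close> fixes it pointwise.\<close>
    define D where "D = {r \<otimes> n \<otimes> inv r \<otimes> inv n | r n. r \<in> W \<and> n \<in> W} \<union> {n [^] p | n. n \<in> W}"
    define V where "V = generate S D"
    have DX: "D \<subseteq> X" using com pow by (auto simp: D_def)
    have Dc: "D \<subseteq> carrier S" using DX subgroup.subset[OF X(1)] by blast
    have sV: "subgroup V S" unfolding V_def using Dc by (rule generate_is_subgroup)
    have VX: "V \<subseteq> X" unfolding V_def using DX X(1) by (rule generate_subgroup_incl)
    then have VW: "V \<subset> W" using X by blast
    have DV: "D \<subseteq> V" unfolding V_def by (auto intro: generate.incl)
    have kD: "k d \<in> D" if d: "d \<in> D" for d
    proof -
      consider r n where "d = r \<otimes> n \<otimes> inv r \<otimes> inv n" "r \<in> W" "n \<in> W" | n where "d = n [^] p" "n \<in> W"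
        using d by (auto simp: D_def)
      then show ?thesis
      proof cases
        case 1
        then have "k d = k r \<otimes> k n \<otimes> inv (k r) \<otimes> inv (k n)" using WP
          by (simp add: k(2) Pm Pi kinv subset_iff)
        then show ?thesis using 1 Wk unfolding D_def by blast
      next
        case 2
        then have "k d = k n [^] p" using WP by (simp add: kpow subset_iff)
        then show ?thesis using 2 Wk unfolding D_def by blast
      qed
    qed
    have "k v \<in> V" if "v \<in> V" for v
      using that unfolding V_def
    proof (induction rule: generate.induct)
      case one then show ?case using k1 by (simp add: generate.one)
    next
      case (incl h) then show ?case using kD by (simp add: generate.incl)
    next
      case (inv h)
      then have "k (inv h) = inv (k h)" using kinv DX X(2) WP by blast
      then show ?case using kD[OF inv] by (simp add: generate.inv)
    next
      case (eng h1 h2)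
      then have "h1 \<in> P" "h2 \<in> P" using VW WP unfolding V_def by auto
      then show ?case using eng by (simp add: k(2) generate.eng)
    qed
    then have Vfix: "k v = v" if "v \<in> V" for v using fixed[OF sV VW _ that] by blast
    have Vnorm: "x \<otimes> v \<otimes> inv x \<in> V" if x: "x \<in> W" and v: "v \<in> V" for x v
    proof -
      have vW: "v \<in> W" using v VW by blast
      have "x \<otimes> v \<otimes> inv x \<otimes> inv v \<in> V" using x vW DV unfolding D_def by blast
      then have "(x \<otimes> v \<otimes> inv x \<otimes> inv v) \<otimes> v \<in> V" using v sV by (simp add: subgroup.m_closed)
      then show ?thesis using x vW Wc by (simp add: word_simps)
    qed
    define y where "y = inv w \<otimes> k w"
    have yW: "y \<in> W" using w by (simp add: y_def Wm Wi Wk)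
    have ky: "k y \<noteq> y" using cof[of w] w WP unfolding y_def by blast
    \<comment> \<open>\<open>V\<close> is normal in \<open>W\<close> and fixed by \<open>k\<close>,
      so \<open>w\<close> and \<open>k w\<close> act on it alike and \<open>y\<close> centralizes
      it. Thus \<open>Z\<close> is \<open>k\<close>-invariant and contains the moved element
      \<open>y\<close>. By minimality it is \<open>W\<close>, so \<open>V\<close> is central and
      \<open>W\<close> has class at most two.\<close>
    define Z where "Z = {x \<in> W. \<forall>v\<in>V. x \<otimes> v = v \<otimes> x}"
    have Vc: "v \<in> carrier S" if "v \<in> V" for v using that VW Wc by blast
    have sZ: "subgroup Z S" unfolding Z_def using subgroup_commuting[OF W(1)] Vc by blast
    have "k ` Z \<subseteq> Z"
    proof
      fix a assume "a \<in> k ` Z"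
      then obtain x where x: "a = k x" "x \<in> Z" by auto
      have "k x \<otimes> v = v \<otimes> k x" if v: "v \<in> V" for v
      proof -
        have "x \<in> P" "v \<in> P" using x v VW WP by (auto simp: Z_def)
        moreover have "x \<otimes> v = v \<otimes> x" using x v by (simp add: Z_def)
        ultimately show ?thesis using k(2)[of x v] k(2)[of v x] Vfix[OF v] by metis
      qed
      then show "a \<in> Z" using x Wk by (simp add: Z_def)
    qed
    moreover have "y \<in> Z"
    proof -
      have "y \<otimes> v = v \<otimes> y" if v: "v \<in> V" for v
      proof -
        have vP: "v \<in> P" "w \<in> P" using v VW WP w by auto
        have wc: "w \<in> carrier S" "k w \<in> carrier S" "v \<in> carrier S" using w Wk Wc Vc v by auto
        have "k (w \<otimes> v \<otimes> inv w) = w \<otimes> v \<otimes> inv w" using Vfix[OF Vnorm[OF w(1) v]] .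
        then have e: "k w \<otimes> v \<otimes> inv (k w) = w \<otimes> v \<otimes> inv w"
          using vP by (simp add: k(2) Pm Pi kinv Vfix[OF v])
        have "y \<otimes> v = inv w \<otimes> (k w \<otimes> v \<otimes> inv (k w)) \<otimes> k w"
          using wc by (simp add: y_def word_simps)
        also have "\<dots> = v \<otimes> y" unfolding e using wc by (simp add: y_def word_simps)
        finally show ?thesis .
      qed
      then show ?thesis using yW by (simp add: Z_def)
    qed
    ultimately have "Z = W" using fixed[OF sZ, of y] ky unfolding Z_def by blast
    then have central: "x \<otimes> v = v \<otimes> x" if "x \<in> W" "v \<in> V" for x v
      using that unfolding Z_def by blast
    let ?m = "test_exponent p"
    \<comment> \<open>\<open>y\<close> is \<open>a \<otimes> b\<close>, and the factors of its power
      with exponent \<open>?m\<close> cancel: that power of \<open>w\<close> lies in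
      \<open>V\<close> and is fixed by \<open>k\<close>. So \<open>y\<close> has small order,
      although \<open>k\<close> moves it.\<close>
    define a where "a = inv w"
    define b where "b = k w"
    have abW: "a \<in> W" "b \<in> W" using w Wi Wk by (auto simp: a_def b_def)
    define z where "z = b \<otimes> a \<otimes> inv b \<otimes> inv a"
    have zV: "z \<in> V" using abW DV unfolding z_def D_def by blast
    have apV: "n [^] p \<in> V" if "n \<in> W" for n using that DV unfolding D_def by blast
    have abc: "a \<in> carrier S" "b \<in> carrier S" "z \<in> carrier S" using abW zV Wc Vc by auto
    have "(a \<otimes> b) [^] ?m = a [^] ?m \<otimes> b [^] ?m"
    proof (rule power_mult_class2[OF abc])
      show "b \<otimes> a = z \<otimes> a \<otimes> b" using abc by (simp add: z_def word_simps)
      show "z \<otimes> a = a \<otimes> z" "z \<otimes> b = b \<otimes> z" using central[OF abW(1) zV] central[OF abW(2) zV] by simp_all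
      show "b \<otimes> a [^] p = a [^] p \<otimes> b" using central[OF abW(2) apV[OF abW(1)]] .
      show "p dvd ?m * (?m - 1) div 2" by (rule p_dvd_test_exponent_choose_2)
    qed
    also have "b [^] ?m = w [^] ?m"
    proof -
      obtain j where j: "?m = p * j" using p_dvd_test_exponent by blast
      have "w [^] ?m = (w [^] p) [^] j" using w Wc by (simp add: j nat_pow_pow)
      then have "w [^] ?m \<in> V" using nat_pow_subgroup[OF sV apV[OF w(1)]] by simp
      then show ?thesis using kpow[of w ?m] w WP Vfix by (auto simp: b_def)
    qed
    finally have "y [^] ?m = \<one>" using w Wc by (simp add: a_def b_def y_def nat_pow_inv)
    then have "y \<in> E" using small yW W by blast
    then show False using ky kE by blast
  qed
  \<comment> \<open>The argument used for \<open>V\<close>, now with \<open>E\<close>: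
    \<open>x\<close> and \<open>k x\<close> act alike on \<open>E\<close>, so the commutator lies in
    \<open>C\<close>.\<close>
  have "k (inv x \<otimes> k x) = inv x \<otimes> k x"
  proof (rule fixC)
    let ?y = "inv x \<otimes> k x"
    have xc: "x \<in> carrier S" "k x \<in> carrier S" using x k c by auto
    have "?y \<otimes> e = e \<otimes> ?y" if e: "e \<in> E" for e
    proof -
      have eP: "e \<in> P" and ec: "e \<in> carrier S" using e EP c by auto
      have "x \<otimes> e \<otimes> inv x \<in> E" using normalizer_conj(1)[OF sE _ e] x PR E(2) by blast
      then have "k (x \<otimes> e \<otimes> inv x) = x \<otimes> e \<otimes> inv x" by (rule kE)
      then have eq: "k x \<otimes> e \<otimes> inv (k x) = x \<otimes> e \<otimes> inv x"
        using x eP by (simp add: k(2) Pm Pi kinv kE[OF e])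
      have "?y \<otimes> e = inv x \<otimes> (k x \<otimes> e \<otimes> inv (k x)) \<otimes> k x" using xc ec by (simp add: word_simps)
      also have "\<dots> = e \<otimes> ?y" unfolding eq using xc ec by (simp add: word_simps)
      finally show ?thesis .
    qed
    then show "?y \<in> C" using x by (simp add: C_def Pm Pi k(1))
  qed
  then show ?thesis using cof x by blast
qed

end

section \<open>Saturated fusion systems\<close>

locale saturated_fusion = finite_p_group S p for S (structure) and p +
  fixes F :: "'a set \<Rightarrow> 'a set \<Rightarrow> ('a \<Rightarrow> 'a) set"
  assumes sat: "saturated_fusion_system p S F"
begin

section \<open>Morphisms into \<open>S\<close>\<close>

lemma
  shows F_subgroup: "\<phi> \<in> F P Q \<Longrightarrow> subgroup P S \<and> subgroup Q S"
    and F_inj_homs: "\<phi> \<in> F P Q \<Longrightarrow> \<phi> \<in> inj_homs S P Q"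
    and F_conj: "subgroup P S \<Longrightarrow> subgroup Q S \<Longrightarrow> g \<in> carrier S \<Longrightarrow> conjmap S g P ` P \<subseteq> Q \<Longrightarrow> conjmap S g P \<in> F P Q"
    and F_image: "\<phi> \<in> F P Q \<Longrightarrow> \<phi> \<in> F P (\<phi> ` P)"
    and F_inv: "\<phi> \<in> F P Q \<Longrightarrow> morph_inv P \<phi> \<in> F (\<phi> ` P) P"
    and F_comp: "\<phi> \<in> F P Q \<Longrightarrow> \<psi> \<in> F Q R \<Longrightarrow> (\<lambda>x\<in>P. \<psi> (\<phi> x)) \<in> F P R"
proof -
  have "fusion_system S F" using sat by (simp add: saturated_fusion_system_def)
  note fs = this[unfolded fusion_system_def]
  note fs1 = fs[THEN conjunct1] and fs2 = fs[THEN conjunct2, THEN conjunct1]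
    and fs3 = fs[THEN conjunct2, THEN conjunct2, THEN conjunct1]
    and fs4 = fs[THEN conjunct2, THEN conjunct2, THEN conjunct2, THEN conjunct1]
    and fs5 = fs[THEN conjunct2, THEN conjunct2, THEN conjunct2, THEN conjunct2]
  show "\<phi> \<in> F P Q \<Longrightarrow> subgroup P S \<and> subgroup Q S" using fs1 by blast
  then show "\<phi> \<in> F P Q \<Longrightarrow> \<phi> \<in> inj_homs S P Q" using fs2 by blast
  show "subgroup P S \<Longrightarrow> subgroup Q S \<Longrightarrow> g \<in> carrier S \<Longrightarrow> conjmap S g P ` P \<subseteq> Q \<Longrightarrow> conjmap S g P \<in> F P Q"
    using fs3 by blast
  show "\<phi> \<in> F P Q \<Longrightarrow> \<phi> \<in> F P (\<phi> ` P)" "\<phi> \<in> F P Q \<Longrightarrow> morph_inv P \<phi> \<in> F (\<phi> ` P) P" using fs4 by blast+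
  show "\<phi> \<in> F P Q \<Longrightarrow> \<psi> \<in> F Q R \<Longrightarrow> (\<lambda>x\<in>P. \<psi> (\<phi> x)) \<in> F P R" using fs5 by blast
qed

text \<open>Morphisms from \<open>P\<close> into \<open>S\<close>, as functions whose values outside \<open>P\<close> are irrelevant.\<close>
definition mor :: "'a set \<Rightarrow> ('a \<Rightarrow> 'a) \<Rightarrow> bool" where
  "mor P f \<longleftrightarrow> restrict f P \<in> F P (carrier S)"

lemma mor_cong: "(\<And>x. x \<in> P \<Longrightarrow> f x = g x) \<Longrightarrow> mor P f \<longleftrightarrow> mor P g"
  unfolding mor_def by (metis (no_types, lifting) restrict_ext)

lemma mor_transfer: "mor P f \<Longrightarrow> (\<And>x. x \<in> P \<Longrightarrow> f x = g x) \<Longrightarrow> mor P g"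
  using mor_cong by blast

lemma mor_subgroup: "mor P f \<Longrightarrow> subgroup P S"
  unfolding mor_def using F_subgroup by blast

lemma mor_mult: "mor P f \<Longrightarrow> x \<in> P \<Longrightarrow> y \<in> P \<Longrightarrow> f (x \<otimes> y) = f x \<otimes> f y"
  using F_inj_homs[of "restrict f P" P "carrier S"] subgroup.m_closed[OF mor_subgroup, of P f x y]
  by (fastforce simp: mor_def inj_homs_def hom_def)

lemma mor_closed: "mor P f \<Longrightarrow> x \<in> P \<Longrightarrow> f x \<in> carrier S"
  using F_inj_homs[of "restrict f P" P "carrier S"]
  by (auto simp: mor_def inj_homs_def hom_def Pi_iff)

lemma mor_inj: "mor P f \<Longrightarrow> inj_on f P"
  using F_inj_homs[of "restrict f P" P "carrier S"] by (auto simp: mor_def inj_homs_def inj_on_restrict_eq)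

lemma mor_image: "mor P f \<Longrightarrow> subgroup (f ` P) S"
  using F_subgroup[OF F_image[of "restrict f P" P "carrier S"]] by (simp add: mor_def)

lemma mor_carrier: "mor P f \<Longrightarrow> x \<in> P \<Longrightarrow> x \<in> carrier S"
  using mor_subgroup subgroup.mem_carrier by metis

lemma mor_one: "mor P f \<Longrightarrow> f \<one> = \<one>"
  using mor_mult[of P f \<one> \<one>] mor_closed[of P f \<one>] subgroup.one_closed[OF mor_subgroup] by simp

lemma mor_inverse: "mor P f \<Longrightarrow> x \<in> P \<Longrightarrow> f (inv x) = inv (f x)"
proof -
  assume f: "mor P f" and x: "x \<in> P"
  have ix: "inv x \<in> P" using subgroup.m_inv_closed[OF mor_subgroup[OF f] x] .
  have "f (inv x) \<otimes> f x = \<one>" using mor_mult[OF f ix x] mor_carrier[OF f x] mor_one[OF f] by simp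
  then show ?thesis using mor_closed[OF f] x ix by (metis inv_equality)
qed

lemma mor_conjugate:
  assumes f: "mor P f" and x: "x \<in> P" and g: "g \<in> P"
  shows "f (g \<otimes> x \<otimes> inv g) = f g \<otimes> f x \<otimes> inv (f g)"
  using assms subgroup.m_inv_closed[OF mor_subgroup[OF f] g] subgroup.m_closed[OF mor_subgroup[OF f] g x]
  by (simp add: mor_mult mor_inverse)

lemma conjmap_one: "subgroup P S \<Longrightarrow> conjmap S \<one> P = (\<lambda>x\<in>P. x)"
  using subgroup.mem_carrier[of P S] by (auto simp: conjmap_def intro!: restrict_ext)

lemma incl_F: "subgroup P S \<Longrightarrow> subgroup Q S \<Longrightarrow> P \<subseteq> Q \<Longrightarrow> (\<lambda>x\<in>P. x) \<in> F P Q"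
  using F_conj[of P Q \<one>] by (simp add: conjmap_one)

text \<open>Composing with the inclusion of \<open>Q\<close> leads to \<open>mor\<close>; the
  factorization axiom followed by an inclusion leads back. So a fusion system is determined by its
  morphisms into \<open>S\<close>, and the arguments below can be phrased with
  \<open>mor\<close>.\<close>

lemma F_iff: "\<phi> \<in> F P Q \<longleftrightarrow> \<phi> \<in> extensional P \<and> subgroup Q S \<and> \<phi> ` P \<subseteq> Q \<and> mor P \<phi>"
proof
  assume \<phi>: "\<phi> \<in> F P Q"
  have ext: "\<phi> \<in> extensional P" and im: "\<phi> ` P \<subseteq> Q" using F_inj_homs[OF \<phi>] by (auto simp: inj_homs_def hom_def)
  have Q: "subgroup Q S" using F_subgroup[OF \<phi>] by blast
  have "(\<lambda>x\<in>P. (\<lambda>x\<in>Q. x) (\<phi> x)) \<in> F P (carrier S)"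
    by (rule F_comp[OF \<phi> incl_F[OF Q subgroup_self]]) (rule subgroup.subset[OF Q])
  moreover have "(\<lambda>x\<in>P. (\<lambda>x\<in>Q. x) (\<phi> x)) = restrict \<phi> P" using im by (auto intro!: restrict_ext)
  ultimately show "\<phi> \<in> extensional P \<and> subgroup Q S \<and> \<phi> ` P \<subseteq> Q \<and> mor P \<phi>"
    using ext im Q by (simp add: mor_def)
next
  assume a: "\<phi> \<in> extensional P \<and> subgroup Q S \<and> \<phi> ` P \<subseteq> Q \<and> mor P \<phi>"
  then have "\<phi> \<in> F P (carrier S)" using extensional_restrict[of \<phi> P] by (simp add: mor_def)
  then have "\<phi> \<in> F P (\<phi> ` P)" by (rule F_image)
  moreover have "(\<lambda>x\<in>\<phi> ` P. x) \<in> F (\<phi> ` P) Q" using a mor_image incl_F by blast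
  ultimately have "(\<lambda>x\<in>P. (\<lambda>x\<in>\<phi> ` P. x) (\<phi> x)) \<in> F P Q" by (rule F_comp)
  moreover have "(\<lambda>x\<in>P. (\<lambda>x\<in>\<phi> ` P. x) (\<phi> x)) = \<phi>" using a
    by (auto simp: fun_eq_iff extensional_def)
  ultimately show "\<phi> \<in> F P Q" by simp
qed

lemma mor_conj: "subgroup P S \<Longrightarrow> g \<in> carrier S \<Longrightarrow> mor P (\<lambda>x. g \<otimes> x \<otimes> inv g)"
  using F_conj[OF _ subgroup_self, of P g] subgroup.mem_carrier[of P S]
  by (auto simp: mor_def conjmap_def image_subset_iff)

lemma mor_id: "subgroup P S \<Longrightarrow> mor P (\<lambda>x. x)"
  unfolding mor_def by (simp add: incl_F subgroup_self subgroup.subset)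

lemma mor_comp:
  assumes f: "mor P f" and g: "mor Q g" and "f ` P \<subseteq> Q"
  shows "mor P (\<lambda>x. g (f x))"
proof -
  have "restrict f P \<in> F P Q" using assms mor_subgroup[OF g] mor_cong[of P "restrict f P" f] by (simp add: F_iff)
  from F_comp[OF this, of "restrict g Q"] g
  have "(\<lambda>x\<in>P. restrict g Q (restrict f P x)) \<in> F P (carrier S)" by (simp add: mor_def)
  moreover have "(\<lambda>x\<in>P. restrict g Q (restrict f P x)) = (\<lambda>x\<in>P. g (f x))" using assms by (auto intro!: restrict_ext)
  ultimately show ?thesis by (simp add: mor_def)
qed

lemma mor_restrict: "mor P f \<Longrightarrow> subgroup R S \<Longrightarrow> R \<subseteq> P \<Longrightarrow> mor R f"
  using mor_comp[OF mor_id, of R P f] by auto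

lemma mor_inv_into: 
  assumes f: "mor P f"
  shows "mor (f ` P) (inv_into P f)"
proof -
  have "morph_inv P (restrict f P) \<in> F (f ` P) P" using F_inv[of "restrict f P" P] f by (simp add: mor_def)
  then have "mor (f ` P) (morph_inv P (restrict f P))" by (simp add: F_iff)
  moreover have "morph_inv P (restrict f P) y = inv_into P f y" if y: "y \<in> f ` P" for y
  proof -
    obtain x where x: "x \<in> P" "y = f x" using y by blast
    have i: "inj_on (restrict f P) P" "inj_on f P" using mor_inj[OF f] by (auto simp: inj_on_restrict_eq)
    have "inv_into P (restrict f P) (restrict f P x) = x" by (rule inv_into_f_f[OF i(1) x(1)])
    then show ?thesis using x i inv_into_f_f[OF i(2) x(1)] by (simp add: morph_inv_def)
  qed
  ultimately show ?thesis using mor_cong by blast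
qed

lemma morph_inv_apply: "mor P f \<Longrightarrow> x \<in> P \<Longrightarrow> morph_inv P f (f x) = x"
  using mor_inj by (simp add: morph_inv_def)

lemma F_conjugate_iff: "F_conjugate F P Q \<longleftrightarrow> (\<exists>f. mor P f \<and> f ` P = Q)"
proof
  assume "F_conjugate F P Q"
  then show "\<exists>f. mor P f \<and> f ` P = Q" by (auto simp: F_conjugate_def F_iff)
next
  assume "\<exists>f. mor P f \<and> f ` P = Q"
  then obtain f where f: "mor P f" "f ` P = Q" by blast
  let ?f = "restrict f P"
  have "?f \<in> F P (carrier S)" "?f ` P = Q" using f by (auto simp: mor_def)
  then show "F_conjugate F P Q" unfolding F_conjugate_def using F_image F_inv by metis
qed

section \<open>Fully normalized subgroups and the extension axiom\<close>

text \<open>Images of images of \<open>P\<close> are images of \<open>P\<close>, so one with the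
  largest normalizer among these finitely many subgroups will do.\<close>

lemma fully_normalized_exists:
  assumes P: "subgroup P S"
  shows "\<exists>f. mor P f \<and> fully_normalized S F (f ` P)"
proof -
  let ?I = "{f ` P | f. mor P f}"
  have "?I \<subseteq> Pow (carrier S)" using mor_closed by auto
  then have fI: "finite ?I" using fin by (meson finite_Pow_iff finite_subset)
  have "P \<in> ?I" using mor_id[OF P] by force
  then have "Max ((\<lambda>Q. card (normalizer S Q)) ` ?I) \<in> (\<lambda>Q. card (normalizer S Q)) ` ?I"
    using fI by (intro Max_in finite_imageI) blast+
  then obtain Q where Q: "Q \<in> ?I" "Max ((\<lambda>Q. card (normalizer S Q)) ` ?I) = card (normalizer S Q)"
    by (rule imageE) simp
  have mx: "card (normalizer S Q') \<le> card (normalizer S Q)" if "Q' \<in> ?I" for Q'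
    using Max_ge[OF finite_imageI[OF fI] imageI[OF that], of "\<lambda>Q. card (normalizer S Q)"] Q(2) by simp
  obtain f where f: "mor P f" "Q = f ` P" using Q(1) by blast
  have "g ` Q \<in> ?I" if "mor Q g" for g
    using mor_comp[OF f(1) that] f(2) by (force simp: image_image)
  then have "fully_normalized S F Q" unfolding fully_normalized_def F_conjugate_iff
    using mx mor_image[OF f(1)] f(2) by auto
  then show ?thesis using f by blast
qed

lemma fully_normalized_image:
  assumes Q: "fully_normalized S F Q" and f: "mor Q f"
    and le: "card (normalizer S Q) \<le> card (normalizer S (f ` Q))"
  shows "fully_normalized S F (f ` Q)"
  unfolding fully_normalized_def F_conjugate_iff
proof (intro conjI allI impI)
  show "subgroup (f ` Q) S" using f by (rule mor_image)
  fix Q' assume "\<exists>g. mor (f ` Q) g \<and> g ` f ` Q = Q'"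
  then obtain g where g: "mor (f ` Q) g" "g ` f ` Q = Q'" by blast
  have "F_conjugate F Q Q'" unfolding F_conjugate_iff
    using mor_comp[OF f g(1)] g(2) by (force simp: image_image)
  then show "card (normalizer S Q') \<le> card (normalizer S (f ` Q))"
    using Q le unfolding fully_normalized_def by force
qed

lemma fully_normalized_imp:
  assumes "fully_normalized S F Q"
  shows "fully_centralized S F Q" "sylow_in p (Aut_S S Q) (F Q Q)" "subgroup Q S"
  using assms sat by (auto simp: saturated_fusion_system_def Aut_F_def fully_normalized_def)

text \<open>An element \<open>h\<close> that realizes the transported conjugation automatically
  normalizes the image, so \<open>K\<close> lies in \<open>N_phi\<close>. This turns the extension
  axiom into a criterion on elements, free of \<open>morph_inv\<close> and
  \<open>Aut_S\<close>.\<close>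

lemma extend:
  assumes f: "mor Q f" and fc: "fully_centralized S F (f ` Q)"
    and K: "subgroup K S" "K \<subseteq> normalizer S Q"
    and ex: "\<And>g. g \<in> K \<Longrightarrow> \<exists>h\<in>carrier S. \<forall>x\<in>Q. f (g \<otimes> x \<otimes> inv g) = h \<otimes> f x \<otimes> inv h"
  shows "\<exists>f'. mor K f' \<and> (\<forall>x\<in>Q. f' x = f x)"
proof -
  let ?f = "restrict f Q"
  have Q: "subgroup Q S" and fQ: "subgroup (f ` Q) S" using f mor_subgroup mor_image by auto
  have f': "mor Q ?f" using f mor_cong[of Q ?f f] by simp
  have "?f \<in> F Q (carrier S)" using f by (simp add: mor_def)
  moreover have "fully_centralized S F (?f ` Q)" using fc by simp
  ultimately obtain \<psi> where \<psi>: "\<psi> \<in> F (N_phi S Q ?f) (carrier S)" "\<forall>x\<in>Q. \<psi> x = ?f x"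
    using sat unfolding saturated_fusion_system_def by blast
  have "K \<subseteq> N_phi S Q ?f"
  proof
    fix g assume g: "g \<in> K"
    then obtain h where h: "h \<in> carrier S" "\<forall>x\<in>Q. f (g \<otimes> x \<otimes> inv g) = h \<otimes> f x \<otimes> inv h" using ex by blast
    have gn: "g \<in> normalizer S Q" using g K by blast
    have gx: "g \<otimes> x \<otimes> inv g \<in> Q" if "x \<in> Q" for x using normalizer_conj(1)[OF Q gn that] .
    have "h \<in> normalizer S (f ` Q)"
    proof (unfold normalizer_iff[OF fQ], intro conjI ballI)
      fix y assume "y \<in> f ` Q"
      then obtain x where x: "x \<in> Q" "y = f x" by blast
      then have "h \<otimes> y \<otimes> inv h = f (g \<otimes> x \<otimes> inv g)" using h by simp
      then show "h \<otimes> y \<otimes> inv h \<in> f ` Q" using gx[OF x(1)] by blast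
    qed fact
    moreover have "(\<lambda>y\<in>?f ` Q. ?f (conjmap S g Q (morph_inv Q ?f y))) = conjmap S h (f ` Q)"
    proof
      fix y
      show "(\<lambda>y\<in>?f ` Q. ?f (conjmap S g Q (morph_inv Q ?f y))) y = conjmap S h (f ` Q) y"
      proof (cases "y \<in> f ` Q")
        case True
        then obtain x where x: "x \<in> Q" "y = f x" by blast
        then have "morph_inv Q ?f y = x" using morph_inv_apply[OF f' x(1)] by simp
        then show ?thesis using x h gx by (simp add: conjmap_def)
      qed (simp add: conjmap_def)
    qed
    ultimately show "g \<in> N_phi S Q ?f" unfolding N_phi_def Aut_S_def using gn by simp
  qed
  moreover have "mor (N_phi S Q ?f) \<psi>" using \<psi>(1) by (simp add: F_iff)
  ultimately have "mor K \<psi>" using mor_restrict K(1) by blast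
  then show ?thesis using \<psi>(2) by auto
qed

section \<open>Automorphism groups in a fusion system\<close>

text \<open>The record makes Lagrange's and Sylow's theorems applicable to \<open>F P P\<close>;
  \<open>compose P\<close> keeps products extensional, so that maps agreeing on \<open>P\<close> are
  equal.\<close>

definition AutG :: "'a set \<Rightarrow> ('a \<Rightarrow> 'a) monoid" where
  "AutG P = \<lparr>carrier = F P P, monoid.mult = compose P, one = \<lambda>x\<in>P. x\<rparr>"

lemma AutG_simps [simp]:
  "carrier (AutG P) = F P P" "monoid.mult (AutG P) = compose P" "one (AutG P) = (\<lambda>x\<in>P. x)"
  by (simp_all add: AutG_def)

lemma mem_AutG: "\<phi> \<in> F P P \<longleftrightarrow> \<phi> \<in> extensional P \<and> mor P \<phi> \<and> \<phi> ` P = P"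
proof -
  have "\<phi> ` P = P" if "mor P \<phi>" "\<phi> ` P \<subseteq> P"
    using that mor_inj endo_inj_surj finite_subgroup mor_subgroup by metis
  then show ?thesis by (auto simp: F_iff mor_subgroup)
qed

lemma AutG_closed: "\<phi> \<in> F P P \<Longrightarrow> x \<in> P \<Longrightarrow> \<phi> x \<in> P"
  by (auto simp: mem_AutG)

lemma group_AutG:
  assumes P: "subgroup P S"
  shows "group (AutG P)"
proof (rule groupI)
  fix x y assume "x \<in> carrier (AutG P)" "y \<in> carrier (AutG P)"
  then show "x \<otimes>\<^bsub>AutG P\<^esub> y \<in> carrier (AutG P)"
    using F_comp[of y P P x P] by (simp add: compose_def)
next
  show "\<one>\<^bsub>AutG P\<^esub> \<in> carrier (AutG P)" using incl_F[OF P P] by simp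
next
  fix x y z assume "x \<in> carrier (AutG P)" "y \<in> carrier (AutG P)" "z \<in> carrier (AutG P)"
  then show "x \<otimes>\<^bsub>AutG P\<^esub> y \<otimes>\<^bsub>AutG P\<^esub> z = x \<otimes>\<^bsub>AutG P\<^esub> (y \<otimes>\<^bsub>AutG P\<^esub> z)"
    by (auto simp: compose_def fun_eq_iff AutG_closed)
next
  fix x assume "x \<in> carrier (AutG P)"
  then show "\<one>\<^bsub>AutG P\<^esub> \<otimes>\<^bsub>AutG P\<^esub> x = x"
    by (auto simp: compose_def fun_eq_iff AutG_closed mem_AutG extensional_def)
next
  fix x assume x: "x \<in> carrier (AutG P)"
  then have "morph_inv P x \<in> F P P" using F_inv[of x P P] by (simp add: mem_AutG)
  moreover have "compose P (morph_inv P x) x = (\<lambda>x\<in>P. x)"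
    using x morph_inv_apply[of P x] by (auto simp: compose_def mem_AutG intro!: restrict_ext)
  ultimately show "\<exists>y\<in>carrier (AutG P). y \<otimes>\<^bsub>AutG P\<^esub> x = \<one>\<^bsub>AutG P\<^esub>" by auto
qed

lemma AutG_inv_apply:
  assumes P: "subgroup P S" and a: "a \<in> F P P" and x: "x \<in> P"
  shows "(inv\<^bsub>AutG P\<^esub> a) (a x) = x" "a ((inv\<^bsub>AutG P\<^esub> a) x) = x" "inv\<^bsub>AutG P\<^esub> a \<in> F P P"
proof -
  interpret A: group "AutG P" using P by (rule group_AutG)
  show "inv\<^bsub>AutG P\<^esub> a \<in> F P P" using A.inv_closed a by simp
  have "compose P (inv\<^bsub>AutG P\<^esub> a) a = (\<lambda>x\<in>P. x)" "compose P a (inv\<^bsub>AutG P\<^esub> a) = (\<lambda>x\<in>P. x)"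
    using A.l_inv[of a] A.r_inv[of a] a by auto
  then show "(inv\<^bsub>AutG P\<^esub> a) (a x) = x" "a ((inv\<^bsub>AutG P\<^esub> a) x) = x"
    using x by (metis compose_eq restrict_apply')+
qed

lemma subgroup_Aut_S:
  assumes P: "subgroup P S"
  shows "subgroup (Aut_S S P) (AutG P)"
proof -
  interpret A: group "AutG P" using P by (rule group_AutG)
  have Pc: "x \<in> carrier S" if "x \<in> P" for x using that P by (rule subgroup.mem_carrier[rotated])
  have gn: "g \<in> carrier S" if "g \<in> normalizer S P" for g using that by (simp add: normalizer_iff[OF P])
  note nc = normalizer_conj(1)[OF P]
  have h: "(\<lambda>g. conjmap S g P) \<in> hom (S\<lparr>carrier := normalizer S P\<rparr>) (AutG P)"
  proof (rule homI)
    fix g assume "g \<in> carrier (S\<lparr>carrier := normalizer S P\<rparr>)"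
    then show "conjmap S g P \<in> carrier (AutG P)" using F_conj[OF P P] nc gn by (force simp: conjmap_def)
  next
    fix g h assume "g \<in> carrier (S\<lparr>carrier := normalizer S P\<rparr>)" "h \<in> carrier (S\<lparr>carrier := normalizer S P\<rparr>)"
    then show "conjmap S (g \<otimes>\<^bsub>S\<lparr>carrier := normalizer S P\<rparr>\<^esub> h) P = conjmap S g P \<otimes>\<^bsub>AutG P\<^esub> conjmap S h P"
      using nc gn Pc by (auto simp: conjmap_def compose_def word_simps intro!: restrict_ext)
  qed
  interpret N: group "S\<lparr>carrier := normalizer S P\<rparr>"
    using subgroup_normalizer[OF P] by (rule subgroup.subgroup_is_group) (rule is_group)
  interpret h: group_hom "S\<lparr>carrier := normalizer S P\<rparr>" "AutG P" "\<lambda>g. conjmap S g P"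
    by unfold_locales (rule h)
  show ?thesis using h.img_is_subgroup by (simp add: Aut_S_def)
qed

text \<open>\<open>f\<close> transports conjugation by N_S(P) to a p-group of automorphisms of the
  image, which some automorphism \<open>\<chi>\<close> conjugates into the Sylow subgroup
  \<open>Aut_S\<close>. Then \<open>\<chi>\<close> after \<open>f\<close> satisfies the extension
  criterion on all of N_S(P). Because of \<open>\<chi>\<close>, only the image of \<open>P\<close>
  is preserved and not the values of \<open>f\<close>.\<close>

lemma normalizer_extension:
  assumes f: "mor P f" and fn: "fully_normalized S F (f ` P)"
  shows "\<exists>h. mor (normalizer S P) h \<and> h ` P = f ` P"
proof -
  let ?Q = "f ` P" and ?N = "S\<lparr>carrier := normalizer S P\<rparr>"
  have P: "subgroup P S" and Q: "subgroup ?Q S" using f mor_subgroup mor_image by auto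
  have sN: "subgroup (normalizer S P) S" using P by (rule subgroup_normalizer)
  have gc: "g \<in> carrier S" if "g \<in> normalizer S P" for g using that by (simp add: normalizer_iff[OF P])
  note nc = normalizer_conj(1)[OF P]
  have Pc: "x \<in> carrier S" if "x \<in> P" for x using that P by (rule subgroup.mem_carrier[rotated])
  define \<theta> where "\<theta> g = (\<lambda>y\<in>?Q. f (g \<otimes> inv_into P f y \<otimes> inv g))" for g
  have fi: "inv_into P f (f x) = x" if "x \<in> P" for x using mor_inj[OF f] that by simp
  have \<theta>f: "\<theta> g (f x) = f (g \<otimes> x \<otimes> inv g)" if "x \<in> P" for g x using that fi by (simp add: \<theta>_def)
  have hom: "\<theta> \<in> hom ?N (AutG ?Q)"
  proof (rule homI)
    fix g assume "g \<in> carrier ?N"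
    then have g: "g \<in> normalizer S P" by simp
    have "mor P (\<lambda>x. f (g \<otimes> x \<otimes> inv g))"
      using mor_comp[OF mor_conj[OF P gc[OF g]] f] nc[OF g] by blast
    then have "mor ?Q (\<lambda>y. f (g \<otimes> inv_into P f y \<otimes> inv g))"
      using mor_comp[OF mor_inv_into[OF f], of P "\<lambda>x. f (g \<otimes> x \<otimes> inv g)"]
      by (simp add: image_image fi)
    then have "mor ?Q (\<theta> g)" using mor_cong[of ?Q "\<theta> g"] by (simp add: \<theta>_def)
    moreover have "\<theta> g ` ?Q \<subseteq> ?Q" using \<theta>f nc[OF g] by auto
    moreover have "\<theta> g \<in> extensional ?Q" by (simp add: \<theta>_def)
    ultimately show "\<theta> g \<in> carrier (AutG ?Q)" using Q by (simp add: F_iff)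
  next
    fix g h assume gh: "g \<in> carrier ?N" "h \<in> carrier ?N"
    show "\<theta> (g \<otimes>\<^bsub>?N\<^esub> h) = \<theta> g \<otimes>\<^bsub>AutG ?Q\<^esub> \<theta> h"
    proof
      fix y
      show "\<theta> (g \<otimes>\<^bsub>?N\<^esub> h) y = (\<theta> g \<otimes>\<^bsub>AutG ?Q\<^esub> \<theta> h) y"
      proof (cases "y \<in> ?Q")
        case True
        then obtain x where x: "x \<in> P" "y = f x" by blast
        then have "\<theta> h y = f (h \<otimes> x \<otimes> inv h)" "h \<otimes> x \<otimes> inv h \<in> P" using \<theta>f nc gh by auto
        then show ?thesis using True x gh gc Pc \<theta>f by (simp add: compose_def word_simps)
      qed (simp add: \<theta>_def compose_def)
    qed
  qed
  obtain k where "card (normalizer S P) = p ^ k" using card_subgroup[OF sN] by blast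
  then obtain \<chi> where \<chi>: "\<chi> \<in> F ?Q ?Q"
    and cT: "\<And>g. g \<in> normalizer S P \<Longrightarrow> compose ?Q (compose ?Q \<chi> (\<theta> g)) (inv\<^bsub>AutG ?Q\<^esub> \<chi>) \<in> Aut_S S ?Q"
    using sylow_conj_subset[OF group_AutG[OF Q] subgroup_Aut_S[OF Q] _ subgroup.subgroup_is_group[OF sN is_group] _ prime_p hom, of k]
      fully_normalized_imp(2)[OF fn] by auto
  have \<chi>m: "mor ?Q \<chi>" "\<chi> ` ?Q = ?Q" using \<chi> by (auto simp: mem_AutG)
  define f' where "f' = (\<lambda>x. \<chi> (f x))"
  have f': "mor P f'" unfolding f'_def using mor_comp[OF f \<chi>m(1)] by simp
  have f'P: "f' ` P = ?Q" using \<chi>m(2) by (auto simp: f'_def image_image)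
  have "\<exists>h. mor (normalizer S P) h \<and> (\<forall>x\<in>P. h x = f' x)"
  proof (rule extend[OF f' _ sN])
    show "fully_centralized S F (f' ` P)" using fully_normalized_imp(1)[OF fn] f'P by simp
    fix g assume g: "g \<in> normalizer S P"
    obtain n where n: "n \<in> normalizer S ?Q"
      "compose ?Q (compose ?Q \<chi> (\<theta> g)) (inv\<^bsub>AutG ?Q\<^esub> \<chi>) = conjmap S n ?Q"
      using cT[OF g] by (auto simp: Aut_S_def)
    have "f' (g \<otimes> x \<otimes> inv g) = n \<otimes> f' x \<otimes> inv n" if x: "x \<in> P" for x
    proof -
      have fx: "f x \<in> ?Q" "\<chi> (f x) \<in> ?Q" using x \<chi>m by auto
      have "n \<otimes> f' x \<otimes> inv n = conjmap S n ?Q (\<chi> (f x))" using fx by (simp add: conjmap_def f'_def)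
      also have "\<dots> = compose ?Q (compose ?Q \<chi> (\<theta> g)) (inv\<^bsub>AutG ?Q\<^esub> \<chi>) (\<chi> (f x))" by (simp add: n(2))
      also have "\<dots> = \<chi> (\<theta> g (f x))"
        using fx AutG_inv_apply(1)[OF Q \<chi> fx(1)] by (simp add: compose_def)
      finally show ?thesis using \<theta>f[OF x] by (simp add: f'_def)
    qed
    then show "\<exists>h\<in>carrier S. \<forall>x\<in>P. f' (g \<otimes> x \<otimes> inv g) = h \<otimes> f' x \<otimes> inv h"
      using n(1) by (auto simp: normalizer_iff[OF Q])
  qed simp
  then obtain h where h: "mor (normalizer S P) h" "\<forall>x\<in>P. h x = f' x" by blast
  then have "h ` P = f' ` P" by (intro image_cong) auto
  then show ?thesis using h(1) f'P by metis
qed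

text \<open>By Cauchy's theorem a prime divisor \<open>q\<close> of the order other than
  \<open>p\<close> would give a nontrivial \<open>k\<close> in \<open>C\<close> with k^q = 1,
  against \<open>triv\<close>.\<close>

lemma card_eq_power_if_no_coprime_automorphism:
  assumes P: "subgroup P S"
    and C: "subgroup C (AutG P)"
    and triv: "\<And>k q. k \<in> C \<Longrightarrow> coprime q p \<Longrightarrow> (\<forall>x\<in>P. (k ^^ q) x = x) \<Longrightarrow> \<forall>x\<in>P. k x = x"
    and fC: "finite C"
  shows "\<exists>n. card C = p ^ n"
proof -
  let ?C = "AutG P\<lparr>carrier := C\<rparr>"
  interpret A: group "AutG P" using P by (rule group_AutG)
  interpret C: group ?C using C by (rule subgroup.subgroup_is_group) (rule A.is_group)
  have "card C \<noteq> 0" using fC subgroup.one_closed[OF C] by auto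
  then obtain m where m: "card C = p ^ multiplicity p (card C) * m" "\<not> p dvd m"
    using multiplicity_decompose'[of "card C" p] prime_p by (metis not_prime_unit)
  have "m = 1"
  proof (rule ccontr)
    assume "m \<noteq> 1"
    then obtain q where q: "prime q" "q dvd m" using prime_factor_nat by blast
    then have qp: "coprime q p" using m(2) prime_p by (metis primes_coprime)
    have "q dvd card C" using q(2) m(1) by (metis dvd_mult)
    then obtain j where "order ?C = q ^ 1 * j" by (auto simp: order_def)
    \<comment> \<open>Sylow's theorem with exponent 1 provides a subgroup of order exactly
      \<open>q\<close>.\<close>
    then obtain H where H: "subgroup H ?C" "card H = q ^ 1"
      using sylow_thm[OF q(1) C.is_group, of 1 j] fC by auto
    interpret H: group "?C\<lparr>carrier := H\<rparr>" using H(1) by (rule subgroup.subgroup_is_group) (rule C.is_group)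
    have "H \<noteq> {\<one>\<^bsub>AutG P\<^esub>}" using H(2) prime_gt_1_nat[OF q(1)] by auto
    moreover have "\<one>\<^bsub>AutG P\<^esub> \<in> H" using subgroup.one_closed[OF H(1)] by simp
    ultimately obtain k where k: "k \<in> H" "k \<noteq> (\<lambda>x\<in>P. x)" by auto
    have kC: "k \<in> C" using subgroup.subset[OF H(1)] k by auto
    have kF: "k \<in> F P P" using subgroup.subset[OF C] kC by auto
    have pw: "(k [^]\<^bsub>?C\<lparr>carrier := H\<rparr>\<^esub> i) x = (k ^^ i) x" if "x \<in> P" for i x
      using that
    proof (induction i arbitrary: x)
      case (Suc i)
      then show ?case using AutG_closed[OF kF] by (simp add: compose_def funpow_swap1)
    qed simp
    have "k [^]\<^bsub>?C\<lparr>carrier := H\<rparr>\<^esub> q = (\<lambda>x\<in>P. x)"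
      using H.pow_order_eq_1[of k] k H(2) by (simp add: order_def)
    then have "\<forall>x\<in>P. (k ^^ q) x = x" using pw[of _ q] by auto
    then have "\<forall>x\<in>P. k x = x" using triv[OF kC qp] by blast
    then have "k = (\<lambda>x\<in>P. x)" using kF by (auto simp: mem_AutG fun_eq_iff extensional_def)
    then show False using k by simp
  qed
  then show ?thesis using m(1) by auto
qed

text \<open>The pointwise stabilizer \<open>C\<close> of \<open>E\<close> is a p-group by
  \<open>triv\<close> and is normal in the setwise stabilizer \<open>M\<close>. Since N_S(P)
  normalizes \<open>E\<close>, \<open>Aut_S\<close> is contained in \<open>M\<close> and is a Sylow
  subgroup of it. So it contains a conjugate of \<open>C\<close>, hence \<open>C\<close>
  itself.\<close>

lemma centralizing_automorphism_inner:
  assumes fn: "fully_normalized S F P" and E: "E \<subseteq> P" "normalizer S P \<subseteq> normalizer S E" "subgroup E S"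
    and triv: "\<And>k q. mor P k \<Longrightarrow> k ` P = P \<Longrightarrow> (\<forall>x\<in>E. k x = x) \<Longrightarrow> coprime q p \<Longrightarrow>
       (\<forall>x\<in>P. (k ^^ q) x = x) \<Longrightarrow> \<forall>x\<in>P. k x = x"
    and k: "mor P k" "k ` P = P" "\<And>x. x \<in> E \<Longrightarrow> k x = x"
  shows "\<exists>g\<in>normalizer S P. \<forall>x\<in>P. k x = g \<otimes> x \<otimes> inv g"
proof -
  have P: "subgroup P S" using fn by (rule fully_normalized_imp)
  interpret A: group "AutG P" using P by (rule group_AutG)
  define C where "C = {\<phi> \<in> F P P. \<forall>x\<in>E. \<phi> x = x}"
  define M where "M = {\<phi> \<in> F P P. \<phi> ` E = E}"
  have fF: "finite (F P P)" using fully_normalized_imp(2)[OF fn] by (simp add: sylow_in_def)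
  have mF: "compose P a b \<in> F P P" if "a \<in> F P P" "b \<in> F P P" for a b
    using A.m_closed[of a b] that by simp
  note iF = AutG_inv_apply[OF P]
  have oF: "(\<lambda>x\<in>P. x) \<in> F P P" using A.one_closed by simp
  have EP: "x \<in> P" if "x \<in> E" for x using that E by blast
  have sC: "subgroup C (AutG P)"
  proof
    show "C \<subseteq> carrier (AutG P)" by (auto simp: C_def)
    show "\<one>\<^bsub>AutG P\<^esub> \<in> C" using oF EP by (auto simp: C_def)
    show "a \<otimes>\<^bsub>AutG P\<^esub> b \<in> C" if "a \<in> C" "b \<in> C" for a b
      using that mF EP by (auto simp: C_def compose_def)
    show "inv\<^bsub>AutG P\<^esub> a \<in> C" if a: "a \<in> C" for a
    proof -
      have aF: "a \<in> F P P" using a by (simp add: C_def)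
      have "(inv\<^bsub>AutG P\<^esub> a) x = x" if "x \<in> E" for x
        using iF(1)[OF aF EP[OF that]] a that by (simp add: C_def)
      then show ?thesis using A.inv_closed aF by (auto simp: C_def)
    qed
  qed
  have sM: "subgroup M (AutG P)"
  proof
    show "M \<subseteq> carrier (AutG P)" by (auto simp: M_def)
    show "\<one>\<^bsub>AutG P\<^esub> \<in> M" using oF EP by (auto simp: M_def)
    show "a \<otimes>\<^bsub>AutG P\<^esub> b \<in> M" if ab: "a \<in> M" "b \<in> M" for a b
    proof -
      have "compose P a b ` E = a ` b ` E" using EP by (auto simp: compose_def image_image intro!: image_cong)
      then show ?thesis using ab mF by (auto simp: M_def)
    qed
    show "inv\<^bsub>AutG P\<^esub> a \<in> M" if a: "a \<in> M" for a
    proof -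
      have aF: "a \<in> F P P" and aE: "a ` E = E" using a by (auto simp: M_def)
      have "(inv\<^bsub>AutG P\<^esub> a) ` E = (inv\<^bsub>AutG P\<^esub> a) ` a ` E" using aE by simp
      also have "\<dots> = E" unfolding image_image using iF(1)[OF aF] EP by simp
      finally show ?thesis using A.inv_closed aF by (auto simp: M_def)
    qed
  qed
  have CM: "C \<subseteq> M" by (auto simp: C_def M_def)
  have TM: "Aut_S S P \<subseteq> M"
  proof
    fix t assume t: "t \<in> Aut_S S P"
    then obtain g where g: "g \<in> normalizer S P" "t = conjmap S g P" by (auto simp: Aut_S_def)
    have tF: "t \<in> F P P" using subgroup.subset[OF subgroup_Aut_S[OF P]] t by auto
    have "t ` E \<subseteq> E" using g E normalizer_conj(1)[OF E(3)] by (auto simp: conjmap_def subset_iff)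
    moreover have "inj_on t E" using tF inj_on_subset[OF mor_inj E(1)] by (simp add: mem_AutG)
    ultimately have "t ` E = E" using endo_inj_surj finite_subgroup[OF E(3)] by blast
    then show "t \<in> M" using tF by (simp add: M_def)
  qed
  let ?M = "AutG P\<lparr>carrier := M\<rparr>" and ?C = "AutG P\<lparr>carrier := C\<rparr>"
  interpret M: group ?M using sM by (rule subgroup.subgroup_is_group) (rule A.is_group)
  interpret C: group ?C using sC by (rule subgroup.subgroup_is_group) (rule A.is_group)
  have fC: "finite C" by (rule finite_subset[OF _ fF]) (auto simp: C_def)
  have fM: "finite M" by (rule finite_subset[OF _ fF]) (auto simp: M_def)
  have "\<exists>n. card C = p ^ n"
    by (rule card_eq_power_if_no_coprime_automorphism[OF P sC _ fC]) (use triv in \<open>auto simp: C_def mem_AutG\<close>)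
  then obtain n where n: "card C = p ^ n" by blast
  have TsM: "subgroup (Aut_S S P) ?M" using A.subgroup_incl[OF subgroup_Aut_S[OF P] sM TM] .
  \<comment> \<open>The order of \<open>Aut_S\<close> is the full p-part of that of
    \<open>F P P\<close>, and it divides the order of \<open>M\<close>, which divides that of
    \<open>F P P\<close>; so the p-parts of all three agree.\<close>
  have syl: "sylow_in p (Aut_S S P) (carrier ?M)"
  proof -
    have cT: "card (Aut_S S P) = p ^ multiplicity p (card (F P P))"
      using fully_normalized_imp(2)[OF fn] by (simp add: sylow_in_def)
    have d1: "card M dvd card (F P P)" using A.lagrange[OF sM] by (metis dvd_triv_right order_def AutG_simps(1))
    have d2: "card (Aut_S S P) dvd card M"
      using M.lagrange[OF TsM] by (metis dvd_triv_right order_def partial_object.select_convs(1) partial_object.simps(3) partial_object.update_convs(1) partial_object.surjective)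
    have nz: "card M \<noteq> 0" "card (F P P) \<noteq> 0" using fM fF oF subgroup.one_closed[OF sM] by auto
    have "multiplicity p (card M) \<le> multiplicity p (card (F P P))"
      using d1 nz by (simp add: dvd_imp_multiplicity_le)
    moreover have "multiplicity p (card (F P P)) \<le> multiplicity p (card M)"
      using d2 cT nz prime_p by (intro multiplicity_geI) (auto simp: prime_gt_0_nat)
    ultimately show ?thesis using TM fM cT by (simp add: sylow_in_def)
  qed
  have "(\<lambda>c. c) \<in> hom ?C ?M" using CM by (auto simp: hom_def)
  then obtain a where a: "a \<in> M" and ac: "\<And>c. c \<in> C \<Longrightarrow> a \<otimes>\<^bsub>?M\<^esub> c \<otimes>\<^bsub>?M\<^esub> inv\<^bsub>?M\<^esub> a \<in> Aut_S S P"
    using sylow_conj_subset[OF M.is_group TsM syl C.is_group _ prime_p, of n "\<lambda>c. c"] n by auto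
  have aF: "a \<in> F P P" and aE: "a ` E = E" using a by (auto simp: M_def)
  \<comment> \<open>Here normality of \<open>C\<close> enters: the conjugate \<open>c\<close> of
    \<open>k\<close> still fixes \<open>E\<close>, and conjugating it back by \<open>a\<close> puts
    \<open>k\<close> into \<open>Aut_S S P\<close>.\<close>
  define c where "c = compose P (compose P (inv\<^bsub>AutG P\<^esub> a) (restrict k P)) a"
  have kF: "restrict k P \<in> F P P" using k mor_cong[of P "restrict k P" k] by (simp add: mem_AutG)
  have cF: "c \<in> F P P" unfolding c_def using mF aF kF A.inv_closed[of a] by simp
  have "c x = x" if x: "x \<in> E" for x
  proof -
    have "a x \<in> E" using aE x by blast
    then show ?thesis using iF(1)[OF aF EP[OF x]] EP[OF x] EP[of "a x"] k(3) AutG_closed[OF aF]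
      by (simp add: c_def compose_def)
  qed
  then have "c \<in> C" using cF by (simp add: C_def)
  then have "a \<otimes>\<^bsub>AutG P\<^esub> c \<otimes>\<^bsub>AutG P\<^esub> inv\<^bsub>AutG P\<^esub> a \<in> Aut_S S P"
    using ac A.m_inv_consistent[OF sM a] by simp
  also have "a \<otimes>\<^bsub>AutG P\<^esub> c \<otimes>\<^bsub>AutG P\<^esub> inv\<^bsub>AutG P\<^esub> a = restrict k P"
  proof -
    have "c = inv\<^bsub>AutG P\<^esub> a \<otimes>\<^bsub>AutG P\<^esub> restrict k P \<otimes>\<^bsub>AutG P\<^esub> a" by (simp add: c_def)
    then show ?thesis using A.conjugation_is_surj[of a "restrict k P"] aF kF by simp
  qed
  finally obtain g where g: "g \<in> normalizer S P" "restrict k P = conjmap S g P"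
    unfolding Aut_S_def by blast
  then have "k x = g \<otimes> x \<otimes> inv g" if "x \<in> P" for x
    using that by (metis conjmap_def restrict_apply')
  then show ?thesis using g by blast
qed

lemma test_subgroup_image:
  assumes f: "mor A f" and A: "test_subgroup p S A"
  shows "test_subgroup p S (f ` A)"
proof -
  have pow: "f x [^] (i::nat) = f (x [^] i)" if "x \<in> A" for x i
    by (induction i) (auto simp: mor_one[OF f] mor_mult[OF f nat_pow_subgroup[OF mor_subgroup[OF f] that] that])
  have "f x [^] test_exponent p = \<one>" if "x \<in> A" for x
    using A that pow[OF that] mor_one[OF f] by (simp add: test_subgroup_iff)
  moreover have "f x \<otimes> f y = f y \<otimes> f x" if "x \<in> A" "y \<in> A" for x y
    using A that mor_mult[OF f] by (metis test_subgroup_iff)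
  ultimately show ?thesis using mor_image[OF f] by (auto simp: test_subgroup_iff)
qed

end

section \<open>Two fusion systems agreeing on test subgroups\<close>

locale nested_fusion = F: saturated_fusion S p \<F> + G: saturated_fusion S p \<G>
  for S (structure) and p \<F> \<G> +
  assumes sub: "\<And>P Q. \<G> P Q \<subseteq> \<F> P Q"
    and eq_test: "\<And>A B. test_subgroup p S A \<Longrightarrow> test_subgroup p S B \<Longrightarrow> \<G> A B = \<F> A B"
begin

section \<open>Automorphisms of a fully normalized subgroup\<close>

lemma G_imp_F: "G.mor P f \<Longrightarrow> F.mor P f"
  using sub by (auto simp: G.mor_def F.mor_def)

lemma F_imp_G_test:
  assumes A: "test_subgroup p S A" and f: "F.mor A f"
  shows "G.mor A f"
proof -
  let ?f = "restrict f A"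
  have "test_subgroup p S (f ` A)" using F.test_subgroup_image[OF f A] .
  moreover have "?f \<in> \<F> A (f ` A)"
    using f F.mor_cong[of A ?f f] F.mor_image[OF f] by (simp add: F.F_iff)
  ultimately have "?f \<in> \<G> A (f ` A)" using eq_test[OF A] by simp
  then show ?thesis using G.mor_cong[of A ?f f] by (simp add: G.F_iff)
qed

text \<open>The inverse of \<open>\<phi>\<close> factors as \<open>\<gamma>\<close> after
  \<open>\<psi>\<close>, with \<open>\<psi>\<close> in \<open>\<G>\<close> by construction and
  \<open>\<gamma>\<close> trivial on \<open>E\<close>. The hypothesis \<open>inner\<close> controls
  automorphisms that fix \<open>E\<close>, and \<open>IH\<close> applies once
  \<open>\<gamma>\<close> extends to a larger group.\<close>

lemma automorphism_step:
  assumes fn: "fully_normalized S \<F> P" and fnE: "fully_normalized S \<G> E"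
    and E: "test_subgroup p S E" "E \<subseteq> P" "normalizer S P \<subseteq> normalizer S E"
    and inner: "\<And>k. F.mor P k \<Longrightarrow> k ` P = P \<Longrightarrow> (\<forall>x\<in>E. k x = x) \<Longrightarrow>
       \<exists>g\<in>normalizer S P. \<forall>x\<in>P. k x = g \<otimes> x \<otimes> inv g"
    and IH: "\<And>K f. card P < card K \<Longrightarrow> F.mor K f \<Longrightarrow> G.mor K f"
    and \<phi>: "F.mor P \<phi>" "\<phi> ` P = P"
  shows "G.mor P \<phi>"
proof -
  have P: "subgroup P S" and sE: "subgroup E S"
    using F.mor_subgroup[OF \<phi>(1)] E(1) by (auto simp: test_subgroup_iff)
  have Pc: "x \<in> carrier S" if "x \<in> P" for x using that P by (rule subgroup.mem_carrier[rotated])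
  have Ec: "x \<in> carrier S" if "x \<in> E" for x using that sE by (rule subgroup.mem_carrier[rotated])
  have PE: "u \<otimes> e \<otimes> inv u \<in> E" if "u \<in> P" "e \<in> E" for u e
    using F.normalizer_conj(1)[OF sE _ that(2)] F.normalizer_self[OF P] E(3) that(1) by blast
  define \<iota> where "\<iota> = inv_into P \<phi>"
  have \<iota>\<phi>: "\<iota> (\<phi> x) = x" if "x \<in> P" for x using that F.mor_inj[OF \<phi>(1)] by (simp add: \<iota>_def)
  have \<phi>\<iota>: "\<phi> (\<iota> x) = x" if "x \<in> P" for x using that \<phi>(2) by (metis \<iota>_def f_inv_into_f)
  have \<phi>P: "\<phi> x \<in> P" if "x \<in> P" for x using that \<phi>(2) by blast
  have \<iota>: "F.mor P \<iota>" using F.mor_inv_into[OF \<phi>(1)] \<phi>(2) by (simp add: \<iota>_def)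
  have \<iota>P: "\<iota> ` P = P" using \<iota>\<phi> \<phi>(2) by (metis (no_types, lifting) image_cong image_ident image_image)
  have EP: "x \<in> P" if "x \<in> E" for x using that E by blast
  let ?Q = "\<phi> ` E"
  have \<phi>E: "F.mor E \<phi>" using F.mor_restrict[OF \<phi>(1) sE E(2)] .
  have Q: "subgroup ?Q S" using F.mor_image[OF \<phi>E] .
  have QP: "?Q \<subseteq> P" using \<phi>P EP by blast
  have \<iota>Q: "\<iota> ` ?Q = E" using \<iota>\<phi> EP by (simp add: image_image)
  have G\<iota>: "G.mor ?Q \<iota>"
    using F_imp_G_test[OF F.test_subgroup_image[OF \<phi>E E(1)] F.mor_restrict[OF \<iota> Q QP]] .
  have conjQ: "u \<otimes> x \<otimes> inv u \<in> ?Q" if u: "u \<in> P" and x: "x \<in> ?Q" for u x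
  proof -
    obtain e where e: "e \<in> E" "x = \<phi> e" using x by blast
    obtain v where v: "v \<in> P" "u = \<phi> v" using u \<phi>(2) by blast
    have "u \<otimes> x \<otimes> inv u = \<phi> (v \<otimes> e \<otimes> inv v)" using F.mor_conjugate[OF \<phi>(1) EP[OF e(1)] v(1)] e v by simp
    then show ?thesis using PE[OF v(1) e(1)] by blast
  qed
  \<comment> \<open>On \<open>P\<close> the map \<open>\<iota>\<close> is known only in
    \<open>\<F>\<close>, but for each \<open>g\<close> it supplies the element
    \<open>\<iota> g\<close> that the extension criterion in \<open>\<G>\<close> asks for.\<close>
  have "\<exists>\<psi>. G.mor P \<psi> \<and> (\<forall>x\<in>?Q. \<psi> x = \<iota> x)"
  proof (rule G.extend[OF G\<iota> _ P])
    show "fully_centralized S \<G> (\<iota> ` ?Q)" using G.fully_normalized_imp(1)[OF fnE] \<iota>Q by simp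
    show "P \<subseteq> normalizer S ?Q" using conjQ Pc by (auto simp: F.normalizer_iff[OF Q])
    fix g assume g: "g \<in> P"
    have "\<iota> (g \<otimes> x \<otimes> inv g) = \<iota> g \<otimes> \<iota> x \<otimes> inv (\<iota> g)" if "x \<in> ?Q" for x
      using F.mor_conjugate[OF \<iota> _ g] that QP by blast
    then show "\<exists>h\<in>carrier S. \<forall>x\<in>?Q. \<iota> (g \<otimes> x \<otimes> inv g) = h \<otimes> \<iota> x \<otimes> inv h"
      using F.mor_closed[OF \<iota> g] by blast
  qed
  then obtain \<psi> where \<psi>: "G.mor P \<psi>" "\<And>x. x \<in> ?Q \<Longrightarrow> \<psi> x = \<iota> x" by blast
  let ?P = "\<psi> ` P"
  have P': "subgroup ?P S" using G.mor_image[OF \<psi>(1)] .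
  have P'c: "x \<in> carrier S" if "x \<in> ?P" for x using that P' by (rule subgroup.mem_carrier[rotated])
  have \<psi>\<phi>: "F.mor P (\<lambda>x. \<psi> (\<phi> x))" using F.mor_comp[OF \<phi>(1) G_imp_F[OF \<psi>(1)]] \<phi>(2) by simp
  have \<psi>\<phi>P: "\<psi> (\<phi> x) \<in> ?P" if "x \<in> P" for x using that \<phi>P by blast
  have \<psi>\<phi>E: "\<psi> (\<phi> e) = e" if "e \<in> E" for e using that \<psi>(2) \<iota>\<phi> EP by simp
  have \<psi>\<phi>surj: "\<exists>x\<in>P. v = \<psi> (\<phi> x)" if "v \<in> ?P" for v
    using that \<phi>\<iota> \<iota>P by (metis imageE image_eqI)
  have EP': "E \<subseteq> ?P" using \<psi>\<phi>E \<psi>\<phi>P EP by (metis subsetI)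
  define \<gamma> where "\<gamma> = (\<lambda>y. \<iota> (inv_into P \<psi> y))"
  have i\<psi>: "inv_into P \<psi> (\<psi> x) = x" if "x \<in> P" for x using that G.mor_inj[OF \<psi>(1)] by simp
  have \<gamma>: "F.mor ?P \<gamma>" unfolding \<gamma>_def
    by (rule F.mor_comp[OF F.mor_inv_into[OF G_imp_F[OF \<psi>(1)]] \<iota>]) (simp add: image_image i\<psi>)
  have \<gamma>\<psi>: "\<gamma> (\<psi> x) = \<iota> x" if "x \<in> P" for x using that i\<psi> by (simp add: \<gamma>_def)
  have \<gamma>P: "\<gamma> ` ?P = P" using \<gamma>\<psi> \<iota>P by (simp add: image_image)
  have \<gamma>E: "\<gamma> e = e" if "e \<in> E" for e using \<gamma>\<psi>[of "\<phi> e"] \<psi>\<phi>E[OF that] \<iota>\<phi> \<phi>P EP that by simp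
  \<comment> \<open>Since \<open>\<psi>\<close> after \<open>\<phi>\<close> fixes \<open>E\<close>,
    the groups \<open>P\<close> and \<open>?P\<close> induce the same automorphisms of
    \<open>E\<close>.\<close>
  have act: "\<psi> (\<phi> w) \<otimes> e \<otimes> inv (\<psi> (\<phi> w)) = w \<otimes> e \<otimes> inv w" if "w \<in> P" "e \<in> E" for w e
    using F.mor_conjugate[OF \<psi>\<phi> EP[OF that(2)] that(1)] \<psi>\<phi>E[OF PE[OF that]] \<psi>\<phi>E[OF that(2)] by simp
  have P'E: "v \<otimes> e \<otimes> inv v \<in> E" if "v \<in> ?P" "e \<in> E" for v e
    using \<psi>\<phi>surj[OF that(1)] act[OF _ that(2)] PE[OF _ that(2)] by auto
  have cardP: "card ?P = card P" using card_image[OF G.mor_inj[OF \<psi>(1)]] .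
  have "G.mor ?P \<gamma>"
  proof (cases "centralizer S E \<subseteq> ?P")
    case True
    \<comment> \<open>\<open>w\<close> and \<open>?v\<close> act alike on \<open>E\<close>, so they
      differ by an element of the centralizer of \<open>E\<close>, which is contained in
      \<open>?P\<close> in this case.\<close>
    have "P \<subseteq> ?P"
    proof
      fix w assume w: "w \<in> P"
      let ?v = "\<psi> (\<phi> w)"
      have v: "?v \<in> ?P" using \<psi>\<phi>P[OF w] .
      have vc: "?v \<in> carrier S" and wc: "w \<in> carrier S" using v P'c w Pc by auto
      have "inv ?v \<otimes> w \<in> centralizer S E"
      proof -
        have "inv ?v \<otimes> w \<otimes> e = e \<otimes> (inv ?v \<otimes> w)" if e: "e \<in> E" for e
        proof -
          have "inv ?v \<otimes> w \<otimes> e = inv ?v \<otimes> (w \<otimes> e \<otimes> inv w) \<otimes> w"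
            using vc wc Ec[OF e] by (simp add: F.word_simps)
          also have "\<dots> = inv ?v \<otimes> (?v \<otimes> e \<otimes> inv ?v) \<otimes> w" using act[OF w e] by simp
          also have "\<dots> = e \<otimes> (inv ?v \<otimes> w)" using vc wc Ec[OF e] by (simp add: F.word_simps)
          finally show ?thesis .
        qed
        then show ?thesis using vc wc by (simp add: centralizer_def)
      qed
      then have "?v \<otimes> (inv ?v \<otimes> w) \<in> ?P" using True v P' by (meson subgroup.m_closed subsetD)
      then show "w \<in> ?P" using vc wc by (simp add: F.cancel)
    qed
    then have eq: "?P = P" using cardP F.finite_subgroup[OF P'] by (metis card_subset_eq)
    then obtain g where g: "g \<in> normalizer S P" "\<forall>x\<in>P. \<gamma> x = g \<otimes> x \<otimes> inv g"
      using inner[of \<gamma>] \<gamma> \<gamma>P \<gamma>E by auto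
    have "G.mor P (\<lambda>x. g \<otimes> x \<otimes> inv g)" using G.mor_conj[OF P] g(1) by (simp add: F.normalizer_iff[OF P])
    then show ?thesis unfolding eq by (rule G.mor_transfer) (simp add: g(2))
  next
    case False
    \<comment> \<open>This is the product of \<open>?P\<close> with the centralizer of
      \<open>E\<close>, described through the action on \<open>E\<close>.\<close>
    define H where "H = {g \<in> carrier S. \<exists>u\<in>?P. \<forall>e\<in>E. g \<otimes> e \<otimes> inv g = u \<otimes> e \<otimes> inv u}"
    have sH: "subgroup H S"
    proof
      show "H \<subseteq> carrier S" by (auto simp: H_def)
      show "\<one> \<in> H" unfolding H_def using subgroup.one_closed[OF P'] by blast
      show "g \<otimes> h \<in> H" if gh: "g \<in> H" "h \<in> H" for g h
      proof -
        obtain u v where u: "u \<in> ?P" "\<forall>e\<in>E. g \<otimes> e \<otimes> inv g = u \<otimes> e \<otimes> inv u"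
          and v: "v \<in> ?P" "\<forall>e\<in>E. h \<otimes> e \<otimes> inv h = v \<otimes> e \<otimes> inv v"
          using gh by (auto simp: H_def)
        have cc: "g \<in> carrier S" "h \<in> carrier S" "u \<in> carrier S" "v \<in> carrier S"
          using gh u(1) v(1) P'c by (auto simp: H_def)
        have "g \<otimes> h \<otimes> e \<otimes> inv (g \<otimes> h) = u \<otimes> v \<otimes> e \<otimes> inv (u \<otimes> v)" if e: "e \<in> E" for e
        proof -
          have "g \<otimes> h \<otimes> e \<otimes> inv (g \<otimes> h) = g \<otimes> (h \<otimes> e \<otimes> inv h) \<otimes> inv g"
            using cc Ec[OF e] by (simp add: F.word_simps)
          also have "\<dots> = g \<otimes> (v \<otimes> e \<otimes> inv v) \<otimes> inv g" using v(2) e by simp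
          also have "\<dots> = u \<otimes> (v \<otimes> e \<otimes> inv v) \<otimes> inv u" using u(2) P'E[OF v(1) e] by simp
          also have "\<dots> = u \<otimes> v \<otimes> e \<otimes> inv (u \<otimes> v)" using cc Ec[OF e] by (simp add: F.word_simps)
          finally show ?thesis .
        qed
        moreover have "u \<otimes> v \<in> ?P" using u v P' by (simp add: subgroup.m_closed)
        ultimately show ?thesis unfolding H_def using cc by blast
      qed
      show "inv g \<in> H" if g: "g \<in> H" for g
      proof -
        obtain u where u: "u \<in> ?P" "\<forall>e\<in>E. g \<otimes> e \<otimes> inv g = u \<otimes> e \<otimes> inv u"
          using g by (auto simp: H_def)
        have cc: "g \<in> carrier S" "u \<in> carrier S" using g u P'c by (auto simp: H_def)
        have iu: "inv u \<in> ?P" using u P' by (simp add: subgroup.m_inv_closed)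
        have "inv g \<otimes> e \<otimes> inv (inv g) = inv u \<otimes> e \<otimes> inv (inv u)" if e: "e \<in> E" for e
        proof -
          let ?e = "inv u \<otimes> e \<otimes> inv (inv u)"
          have "g \<otimes> ?e \<otimes> inv g = u \<otimes> ?e \<otimes> inv u" using u(2) P'E[OF iu e] by blast
          also have "\<dots> = e" using cc Ec[OF e] by (simp add: F.word_simps)
          finally have "inv g \<otimes> e \<otimes> inv (inv g) = inv g \<otimes> (g \<otimes> ?e \<otimes> inv g) \<otimes> g" using cc by simp
          also have "\<dots> = ?e" using cc Ec[OF e] by (simp add: F.word_simps)
          finally show ?thesis .
        qed
        then show ?thesis unfolding H_def using cc iu by blast
      qed
    qed
    have "?P \<subseteq> H" using P'c by (auto simp: H_def)
    moreover have "centralizer S E \<subseteq> H"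
    proof
      fix c assume c: "c \<in> centralizer S E"
      have "c \<otimes> e \<otimes> inv c = \<one> \<otimes> e \<otimes> inv \<one>" if e: "e \<in> E" for e
        using c e Ec[OF e] by (simp add: centralizer_def F.m_assoc)
      then show "c \<in> H" using c subgroup.one_closed[OF P'] unfolding H_def centralizer_def by blast
    qed
    ultimately have "?P \<subset> H" using False by blast
    then obtain g0 where g0: "g0 \<in> H - ?P" "\<forall>x\<in>?P. g0 \<otimes> x \<otimes> inv g0 \<in> ?P"
      using F.normalizers_grow[OF P' sH] by blast
    \<comment> \<open>\<open>?P\<close> is a proper subgroup of \<open>H\<close>, so it is properly
      contained in its normalizer \<open>K\<close> in \<open>H\<close>, and \<open>IH\<close> covers
      morphisms on \<open>K\<close>.\<close>
    define K where "K = H \<inter> normalizer S ?P"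
    have sK: "subgroup K S" unfolding K_def using sH F.subgroup_normalizer[OF P'] by (rule F.subgroups_Inter_pair)
    have "g0 \<in> K" using g0 subgroup.mem_carrier[OF sH] by (auto simp: K_def F.normalizer_iff[OF P'])
    moreover have PK: "?P \<subseteq> K" using \<open>?P \<subseteq> H\<close> F.normalizer_self[OF P'] by (auto simp: K_def)
    ultimately have "?P \<subset> K" using g0 by blast
    then have cK: "card P < card K" using cardP F.finite_subgroup[OF sK] by (metis psubset_card_mono)
    have "\<exists>f'. F.mor K f' \<and> (\<forall>x\<in>?P. f' x = \<gamma> x)"
    proof (rule F.extend[OF \<gamma> _ sK])
      show "fully_centralized S \<F> (\<gamma> ` ?P)" using F.fully_normalized_imp(1)[OF fn] \<gamma>P by simp
      show "K \<subseteq> normalizer S ?P" by (auto simp: K_def)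
      fix g assume g: "g \<in> K"
      then obtain u where u: "u \<in> ?P" "\<forall>e\<in>E. g \<otimes> e \<otimes> inv g = u \<otimes> e \<otimes> inv u" by (auto simp: K_def H_def)
      \<comment> \<open>In g = uc the factor \<open>u\<close> is in \<open>?P\<close>, and
        \<open>c\<close> centralizes \<open>E\<close> and normalizes \<open>?P\<close>. Transported
        by \<open>\<gamma>\<close>, conjugation by \<open>c\<close> becomes an automorphism
        \<open>k\<close> of \<open>P\<close> fixing \<open>E\<close>, which \<open>inner\<close>
        makes conjugation by some \<open>n\<close>. So \<open>\<gamma> u \<otimes> n\<close>
        realizes the conjugation by \<open>g\<close>.\<close>
      define c where "c = inv u \<otimes> g"
      have cc: "g \<in> carrier S" "u \<in> carrier S" "c \<in> carrier S"
        using g u(1) P'c subgroup.mem_carrier[OF sK] by (auto simp: c_def)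
      have gu: "g = u \<otimes> c" using cc by (simp add: c_def F.cancel)
      have cn: "c \<in> normalizer S ?P" unfolding c_def
        using g subsetD[OF F.normalizer_self[OF P'] u(1)] F.subgroup_normalizer[OF P']
        by (simp add: K_def subgroup.m_closed subgroup.m_inv_closed)
      have cE: "c \<otimes> e \<otimes> inv c = e" if e: "e \<in> E" for e
      proof -
        have "c \<otimes> e \<otimes> inv c = inv u \<otimes> (g \<otimes> e \<otimes> inv g) \<otimes> u" using cc Ec[OF e] by (simp add: c_def F.word_simps)
        also have "\<dots> = inv u \<otimes> (u \<otimes> e \<otimes> inv u) \<otimes> u" using u(2) e by simp
        also have "\<dots> = e" using cc Ec[OF e] by (simp add: F.word_simps)
        finally show ?thesis .
      qed
      define k where "k = (\<lambda>y. \<gamma> (c \<otimes> inv_into ?P \<gamma> y \<otimes> inv c))"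
      have i\<gamma>: "inv_into ?P \<gamma> (\<gamma> x) = x" if "x \<in> ?P" for x using that F.mor_inj[OF \<gamma>] by simp
      have k\<gamma>: "k (\<gamma> x) = \<gamma> (c \<otimes> x \<otimes> inv c)" if "x \<in> ?P" for x using that i\<gamma> by (simp add: k_def)
      have cP: "c \<otimes> x \<otimes> inv c \<in> ?P" if "x \<in> ?P" for x using F.normalizer_conj(1)[OF P' cn that] .
      have m1: "F.mor ?P (\<lambda>x. \<gamma> (c \<otimes> x \<otimes> inv c))"
        using F.mor_comp[OF F.mor_conj[OF P' cc(3)] \<gamma>] cP by blast
      have "inv_into ?P \<gamma> ` \<gamma> ` ?P \<subseteq> ?P" using i\<gamma> by auto
      from F.mor_comp[OF F.mor_inv_into[OF \<gamma>] m1 this]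
      have km: "F.mor P k" using \<gamma>P by (simp add: k_def)
      have "k ` P \<subseteq> P"
      proof
        fix y assume "y \<in> k ` P"
        then obtain w where w: "w \<in> P" "y = k w" by blast
        then obtain x where x: "x \<in> ?P" "w = \<gamma> x" using \<gamma>P by (metis imageE)
        then have "y = \<gamma> (c \<otimes> x \<otimes> inv c)" using w k\<gamma> by simp
        then show "y \<in> P" using cP[OF x(1)] \<gamma>P by (metis imageI)
      qed
      then have kP: "k ` P = P" using F.mor_inj[OF km] endo_inj_surj F.finite_subgroup[OF P] by metis
      have kE: "k e = e" if e: "e \<in> E" for e
        using k\<gamma>[of e] e EP' \<gamma>E[OF e] cE[OF e] by auto
      obtain n where n: "n \<in> normalizer S P" "\<forall>x\<in>P. k x = n \<otimes> x \<otimes> inv n"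
        using inner[OF km kP] kE by blast
      have nc: "n \<in> carrier S" using n(1) by (simp add: F.normalizer_iff[OF P])
      have \<gamma>u: "\<gamma> u \<in> carrier S" using F.mor_closed[OF \<gamma> u(1)] .
      have "\<gamma> (g \<otimes> x \<otimes> inv g) = (\<gamma> u \<otimes> n) \<otimes> \<gamma> x \<otimes> inv (\<gamma> u \<otimes> n)" if x: "x \<in> ?P" for x
      proof -
        have xc: "x \<in> carrier S" and \<gamma>x: "\<gamma> x \<in> carrier S" "\<gamma> x \<in> P"
          using P'c[OF x] F.mor_closed[OF \<gamma> x] \<gamma>P x by auto
        have "g \<otimes> x \<otimes> inv g = u \<otimes> (c \<otimes> x \<otimes> inv c) \<otimes> inv u" using cc xc by (simp add: gu F.word_simps)
        then have "\<gamma> (g \<otimes> x \<otimes> inv g) = \<gamma> u \<otimes> \<gamma> (c \<otimes> x \<otimes> inv c) \<otimes> inv (\<gamma> u)"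
          using F.mor_conjugate[OF \<gamma> cP[OF x] u(1)] by simp
        also have "\<gamma> (c \<otimes> x \<otimes> inv c) = n \<otimes> \<gamma> x \<otimes> inv n" using k\<gamma>[OF x] n(2) \<gamma>x by simp
        finally show ?thesis using nc \<gamma>u \<gamma>x by (simp add: F.word_simps)
      qed
      then show "\<exists>h\<in>carrier S. \<forall>x\<in>?P. \<gamma> (g \<otimes> x \<otimes> inv g) = h \<otimes> \<gamma> x \<otimes> inv h"
        using nc \<gamma>u by (meson F.m_closed)
    qed
    then obtain f' where f': "F.mor K f'" "\<forall>x\<in>?P. f' x = \<gamma> x" by blast
    have "G.mor ?P f'" using G.mor_restrict[OF IH[OF cK f'(1)] P' PK] .
    then show ?thesis by (rule G.mor_transfer) (use f'(2) in blast)
  qed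
  then have "G.mor P (\<lambda>x. \<gamma> (\<psi> x))" using G.mor_comp[OF \<psi>(1), of ?P \<gamma>] by simp
  then have "G.mor P \<iota>" by (rule G.mor_transfer) (rule \<gamma>\<psi>)
  then have "G.mor P (inv_into P \<iota>)" using G.mor_inv_into[of P \<iota>] \<iota>P by simp
  then show ?thesis
  proof (rule G.mor_transfer)
    show "inv_into P \<iota> x = \<phi> x" if "x \<in> P" for x
      using inv_into_f_f[OF F.mor_inj[OF \<iota>] \<phi>P[OF that]] \<iota>\<phi>[OF that] by simp
  qed
qed

section \<open>Choice of a fully normalized pair\<close>

text \<open>A maximal \<open>E0\<close> is chosen first, below a fully normalized \<open>P0\<close>.
  Then the pair is moved by a morphism \<open>\<alpha>\<close> of \<open>\<G>\<close> on N_S(E0)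
  which makes the image of \<open>E0\<close> fully normalized in \<open>\<G>\<close>. As N_S(E0)
  contains N_S(P0), that normalizer is carried along, and the image of \<open>P0\<close> stays fully
  normalized in \<open>\<F>\<close>.\<close>

lemma exists_good_pair:
  assumes P: "subgroup P S"
  obtains f E where "F.mor P f" "fully_normalized S \<F> (f ` P)" "fully_normalized S \<G> E"
    "test_subgroup p S E" "E \<subseteq> f ` P" "normalizer S (f ` P) \<subseteq> normalizer S E"
    "\<And>k. F.mor (f ` P) k \<Longrightarrow> k ` f ` P = f ` P \<Longrightarrow> (\<forall>x\<in>E. k x = x) \<Longrightarrow>
       \<exists>g\<in>normalizer S (f ` P). \<forall>x\<in>f ` P. k x = g \<otimes> x \<otimes> inv g"
proof -
  obtain f0 where f0: "F.mor P f0" "fully_normalized S \<F> (f0 ` P)" using F.fully_normalized_exists[OF P] by blast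
  define P0 where "P0 = f0 ` P"
  define R0 where "R0 = normalizer S P0"
  have sP0: "subgroup P0 S" unfolding P0_def using F.mor_image[OF f0(1)] .
  have sR0: "subgroup R0 S" unfolding R0_def using F.subgroup_normalizer[OF sP0] .
  have PR: "P0 \<subseteq> R0" unfolding R0_def using F.normalizer_self[OF sP0] .
  let ?\<E> = "{L. test_subgroup p S L \<and> L \<subseteq> P0 \<and> R0 \<subseteq> normalizer S L}"
  have "finite ?\<E>" by (rule finite_subset[of _ "Pow P0"]) (auto simp: F.finite_subgroup[OF sP0])
  moreover have "{\<one>} \<in> ?\<E>"
    using F.triv_subgroup subgroup.one_closed[OF sP0] subgroup.mem_carrier[OF sR0]
    by (auto simp: test_subgroup_iff F.normalizer_iff[OF F.triv_subgroup])
  ultimately obtain E0 where E0C: "E0 \<in> ?\<E>" and mx: "\<And>L. L \<in> ?\<E> \<Longrightarrow> E0 \<subseteq> L \<Longrightarrow> L = E0"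
    using finite_has_maximal2[of ?\<E> "{\<one>}"] by (metis (no_types, lifting))
  then have E0: "test_subgroup p S E0" "E0 \<subseteq> P0" "R0 \<subseteq> normalizer S E0" by auto
  have sE0: "subgroup E0 S" using E0(1) by (simp add: test_subgroup_iff)
  obtain e where e: "G.mor E0 e" "fully_normalized S \<G> (e ` E0)" using G.fully_normalized_exists[OF sE0] by blast
  obtain \<alpha> where \<alpha>: "G.mor (normalizer S E0) \<alpha>" "\<alpha> ` E0 = e ` E0" using G.normalizer_extension[OF e] by blast
  have \<alpha>F: "F.mor (normalizer S E0) \<alpha>" using G_imp_F[OF \<alpha>(1)] .
  have \<alpha>R: "F.mor R0 \<alpha>" using F.mor_restrict[OF \<alpha>F sR0 E0(3)] .
  have \<alpha>P: "F.mor P0 \<alpha>" using F.mor_restrict[OF \<alpha>R sP0 PR] .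
  have \<alpha>E: "F.mor E0 \<alpha>" using F.mor_restrict[OF \<alpha>P sE0 E0(2)] .
  let ?P = "\<alpha> ` P0" and ?E = "\<alpha> ` E0"
  have sP: "subgroup ?P S" and sE: "subgroup ?E S" using F.mor_image \<alpha>P \<alpha>E by auto
  have inR: "x \<in> R0" if "x \<in> P0" for x using that PR by blast
  have inP: "x \<in> P0" if "x \<in> E0" for x using that E0 by blast
  \<comment> \<open>\<open>\<alpha>\<close> embeds the normalizer of \<open>P0\<close> into that of
    its image; since \<open>P0\<close> is fully normalized, the orders force equality.\<close>
  have sub1: "\<alpha> ` R0 \<subseteq> normalizer S ?P"
  proof
    fix g assume "g \<in> \<alpha> ` R0"
    then obtain r where r: "r \<in> R0" "g = \<alpha> r" by blast
    have "g \<otimes> \<alpha> x \<otimes> inv g \<in> ?P" if x: "x \<in> P0" for x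
    proof -
      have "g \<otimes> \<alpha> x \<otimes> inv g = \<alpha> (r \<otimes> x \<otimes> inv r)" using F.mor_conjugate[OF \<alpha>R inR[OF x] r(1)] r by simp
      then show ?thesis using F.normalizer_conj(1)[OF sP0 _ x] r unfolding R0_def by blast
    qed
    then show "g \<in> normalizer S ?P" using F.mor_closed[OF \<alpha>R r(1)] r by (auto simp: F.normalizer_iff[OF sP])
  qed
  have finN: "finite (normalizer S ?P)" using F.finite_subgroup[OF F.subgroup_normalizer[OF sP]] .
  have cR: "card (\<alpha> ` R0) = card R0" using card_image[OF F.mor_inj[OF \<alpha>R]] .
  have le1: "card R0 \<le> card (normalizer S ?P)" using card_mono[OF finN sub1] cR by simp
  have fn0: "fully_normalized S \<F> P0" using f0(2) by (simp add: P0_def)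
  have fnP: "fully_normalized S \<F> ?P" using F.fully_normalized_image[OF fn0 \<alpha>P] le1 by (simp add: R0_def)
  have "F_conjugate \<F> P0 ?P" using \<alpha>P by (auto simp: F.F_conjugate_iff)
  then have "card (normalizer S ?P) \<le> card R0" using fn0 by (simp add: fully_normalized_def R0_def)
  then have NP: "\<alpha> ` R0 = normalizer S ?P" using card_subset_eq[OF finN sub1] cR le1 by simp
  have NE: "normalizer S ?P \<subseteq> normalizer S ?E"
  proof
    fix g assume "g \<in> normalizer S ?P"
    then obtain r where r: "r \<in> R0" "g = \<alpha> r" unfolding NP[symmetric] by blast
    have "g \<otimes> \<alpha> x \<otimes> inv g \<in> ?E" if x: "x \<in> E0" for x
    proof -
      have "g \<otimes> \<alpha> x \<otimes> inv g = \<alpha> (r \<otimes> x \<otimes> inv r)" using F.mor_conjugate[OF \<alpha>R inR[OF inP[OF x]] r(1)] r by simp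
      then show ?thesis using F.normalizer_conj(1)[OF sE0 subsetD[OF E0(3) r(1)] x] by blast
    qed
    then show "g \<in> normalizer S ?E" using F.mor_closed[OF \<alpha>R r(1)] r by (auto simp: F.normalizer_iff[OF sE])
  qed
  \<comment> \<open>The maximality of \<open>E0\<close> is not moved along \<open>\<alpha>\<close>;
    instead \<open>k\<close> is pulled back to an automorphism \<open>k'\<close> of
    \<open>P0\<close>, where maximality is known.\<close>
  have triv: "\<forall>x\<in>?P. k x = x"
    if k: "F.mor ?P k" "k ` ?P = ?P" "\<forall>x\<in>?E. k x = x" and q: "coprime q p" and kq: "\<forall>x\<in>?P. (k ^^ q) x = x" for k q
  proof -
    define k' where "k' = (\<lambda>x. inv_into P0 \<alpha> (k (\<alpha> x)))"
    have i\<alpha>: "inv_into P0 \<alpha> (\<alpha> x) = x" if "x \<in> P0" for x using that F.mor_inj[OF \<alpha>P] by simp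
    have \<alpha>i: "inv_into P0 \<alpha> y \<in> P0" "\<alpha> (inv_into P0 \<alpha> y) = y" if "y \<in> ?P" for y
      using that by (auto simp: inv_into_into f_inv_into_f)
    have kP: "k y \<in> ?P" if "y \<in> ?P" for y using that k(2) by blast
    have "F.mor P0 (\<lambda>x. k (\<alpha> x))" using F.mor_comp[OF \<alpha>P k(1)] by simp
    from F.mor_comp[OF this F.mor_inv_into[OF \<alpha>P]]
    have mk': "F.mor P0 k'" using k(2) unfolding k'_def by (metis image_image subset_refl)
    have k'P: "k' x \<in> P0" if "x \<in> P0" for x using \<alpha>i(1)[OF kP] that by (simp add: k'_def)
    have \<alpha>k': "\<alpha> (k' x) = k (\<alpha> x)" if "x \<in> P0" for x using \<alpha>i(2)[OF kP] that by (simp add: k'_def)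
    have it: "(k' ^^ i) x \<in> P0 \<and> \<alpha> ((k' ^^ i) x) = (k ^^ i) (\<alpha> x)" if "x \<in> P0" for x i
      using that by (induction i) (auto simp: k'P \<alpha>k')
    have "k' x = x" if x: "x \<in> P0" for x
    proof (rule F.coprime_automorphism_trivial[OF sR0 sP0 PR _ E0(1,3,2) _ _ _ _ q _ x])
      show "R0 \<subseteq> normalizer S P0" by (simp add: R0_def)
      show "L = E0" if "test_subgroup p S L" "E0 \<subseteq> L" "L \<subseteq> P0" "R0 \<subseteq> normalizer S L" for L
        using mx that by blast
      show "k' x \<in> P0" if "x \<in> P0" for x using k'P[OF that] .
      show "k' (x \<otimes> y) = k' x \<otimes> k' y" if "x \<in> P0" "y \<in> P0" for x y using F.mor_mult[OF mk' that] .
      show "(k' ^^ q) x = x" if "x \<in> P0" for x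
        using it[OF that, of q] kq that i\<alpha> by (metis imageI)
      show "k' x = x" if "x \<in> E0" for x using k(3) i\<alpha>[OF inP[OF that]] that by (simp add: k'_def)
    qed
    then have "k (\<alpha> x) = \<alpha> x" if "x \<in> P0" for x using \<alpha>k'[OF that] that by simp
    then show ?thesis by blast
  qed
  show thesis
  proof (rule that)
    show "F.mor P (\<lambda>x. \<alpha> (f0 x))" using F.mor_comp[OF f0(1) \<alpha>P] by (simp add: P0_def)
    have im: "(\<lambda>x. \<alpha> (f0 x)) ` P = ?P" by (simp add: P0_def image_image)
    show "fully_normalized S \<F> ((\<lambda>x. \<alpha> (f0 x)) ` P)" using fnP im by simp
    show "fully_normalized S \<G> ?E" using e(2) \<alpha>(2) by simp
    show "test_subgroup p S ?E" using F.test_subgroup_image[OF \<alpha>E E0(1)] .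
    show "?E \<subseteq> (\<lambda>x. \<alpha> (f0 x)) ` P" unfolding im using E0(2) by blast
    show "normalizer S ((\<lambda>x. \<alpha> (f0 x)) ` P) \<subseteq> normalizer S ?E" unfolding im using NE .
    show "\<exists>g\<in>normalizer S ((\<lambda>x. \<alpha> (f0 x)) ` P). \<forall>x\<in>(\<lambda>x. \<alpha> (f0 x)) ` P. k x = g \<otimes> x \<otimes> inv g"
      if "F.mor ((\<lambda>x. \<alpha> (f0 x)) ` P) k" "k ` (\<lambda>x. \<alpha> (f0 x)) ` P = (\<lambda>x. \<alpha> (f0 x)) ` P" "\<forall>x\<in>?E. k x = x" for k
      unfolding im
    proof (rule F.centralizing_automorphism_inner[OF fnP _ NE sE])
      show "?E \<subseteq> ?P" using E0(2) by blast
      show "F.mor ?P k" "k ` ?P = ?P" using that unfolding im by auto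
      show "k x = x" if "x \<in> ?E" for x using that \<open>\<forall>x\<in>?E. k x = x\<close> by blast
      show "\<forall>x\<in>?P. k x = x" if "F.mor ?P k" "k ` ?P = ?P" "\<forall>x\<in>?E. k x = x" "coprime q p"
        "\<forall>x\<in>?P. (k ^^ q) x = x" for k q using triv that by blast
    qed
  qed
qed

section \<open>Downward induction on the order of the source\<close>

text \<open>With isomorphisms \<open>j\<close> and \<open>l\<close> in \<open>\<G>\<close> from
  \<open>P\<close> and from its image under \<open>f\<close> onto the good subgroup
  \<open>?P\<close>, the map f becomes l^-1 \<open>\<phi>\<close> j for an automorphism
  \<open>\<phi>\<close> of \<open>?P\<close> in \<open>\<F>\<close>, to which
  \<open>automorphism_step\<close> applies.\<close>

theorem F_imp_G: "F.mor P f \<Longrightarrow> G.mor P f"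
proof (induction "card (carrier S) - card P" arbitrary: P f rule: less_induct)
  case less
  have P: "subgroup P S" using F.mor_subgroup[OF less.prems] .
  have IH: "G.mor K g" if K: "card P < card K" "F.mor K g" for K g
  proof (rule less.hyps[OF _ K(2)])
    have "card K \<le> card (carrier S)"
      using F.fin subgroup.subset[OF F.mor_subgroup[OF K(2)]] by (rule card_mono)
    then show "card (carrier S) - card K < card (carrier S) - card P" using K(1) by simp
  qed
  obtain f0 E where f0: "F.mor P f0" "fully_normalized S \<F> (f0 ` P)" and E: "fully_normalized S \<G> E"
    "test_subgroup p S E" "E \<subseteq> f0 ` P" "normalizer S (f0 ` P) \<subseteq> normalizer S E"
    and inner: "\<And>k. F.mor (f0 ` P) k \<Longrightarrow> k ` f0 ` P = f0 ` P \<Longrightarrow> (\<forall>x\<in>E. k x = x) \<Longrightarrow>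
       \<exists>g\<in>normalizer S (f0 ` P). \<forall>x\<in>f0 ` P. k x = g \<otimes> x \<otimes> inv g"
    by (rule exists_good_pair[OF P]) (rule that)
  let ?P = "f0 ` P"
  have cardP: "card ?P = card P" using card_image[OF F.mor_inj[OF f0(1)]] .
  \<comment> \<open>The map \<open>i\<close> itself is not claimed to lie in \<open>\<G>\<close>.
    Some morphism of \<open>\<F>\<close> with the same image of \<open>Q\<close> is defined on the
    normalizer of \<open>Q\<close>, which is larger than \<open>Q\<close> unless \<open>Q\<close> is
    \<open>S\<close>, so it is in \<open>\<G>\<close> by \<open>IH\<close>. If \<open>Q\<close> is
    \<open>S\<close>, then so is \<open>?P\<close>, and the identity serves.\<close>
  have conn: "\<exists>j. G.mor Q j \<and> j ` Q = ?P" if i: "F.mor Q i" "i ` Q = ?P" for Q i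
  proof -
    have Q: "subgroup Q S" using F.mor_subgroup[OF i(1)] .
    have cQ: "card Q = card P" using card_image[OF F.mor_inj[OF i(1)]] i(2) cardP by simp
    show ?thesis
    proof (cases "Q = carrier S")
      case True
      have "?P = carrier S"
        using card_subset_eq[OF F.fin subgroup.subset[OF F.mor_image[OF f0(1)]]] cQ cardP True by simp
      then show ?thesis using G.mor_id[OF Q] True by (intro exI[of _ "\<lambda>x. x"]) simp
    next
      case False
      then have "Q \<subset> carrier S" using subgroup.subset[OF Q] by blast
      then obtain g where g: "g \<in> carrier S - Q" "\<forall>x\<in>Q. g \<otimes> x \<otimes> inv g \<in> Q"
        using F.normalizers_grow[OF Q F.subgroup_self] by blast
      then have "g \<in> normalizer S Q" by (simp add: F.normalizer_iff[OF Q])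
      then have "Q \<subset> normalizer S Q" using g F.normalizer_self[OF Q] by blast
      then have lt: "card P < card (normalizer S Q)"
        using cQ psubset_card_mono[OF F.finite_subgroup[OF F.subgroup_normalizer[OF Q]]] by metis
      obtain h where h: "F.mor (normalizer S Q) h" "h ` Q = ?P"
        using F.normalizer_extension[OF i(1)] f0(2) i(2) by auto
      show ?thesis using G.mor_restrict[OF IH[OF lt h(1)] Q F.normalizer_self[OF Q]] h(2) by blast
    qed
  qed
  obtain j where j: "G.mor P j" "j ` P = ?P" using conn[OF f0(1)] by blast
  have f: "F.mor P f" by fact
  have "F.mor (f ` P) (\<lambda>y. f0 (inv_into P f y))"
    by (rule F.mor_comp[OF F.mor_inv_into[OF f] f0(1)]) (auto simp: F.mor_inj[OF f])
  moreover have "(\<lambda>y. f0 (inv_into P f y)) ` f ` P = ?P"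
    by (simp add: image_image F.mor_inj[OF f])
  ultimately obtain l where l: "G.mor (f ` P) l" "l ` f ` P = ?P"
    using conn[of "f ` P" "\<lambda>y. f0 (inv_into P f y)"] by metis
  have lf: "F.mor P (\<lambda>x. l (f x))" using F.mor_comp[OF f G_imp_F[OF l(1)]] by simp
  have ji: "inv_into P j (j x) = x" if "x \<in> P" for x using that G.mor_inj[OF j(1)] by simp
  define \<phi> where "\<phi> = (\<lambda>y. l (f (inv_into P j y)))"
  have \<phi>j: "\<phi> (j x) = l (f x)" if "x \<in> P" for x using that ji by (simp add: \<phi>_def)
  have "inv_into P j ` j ` P \<subseteq> P" using ji by auto
  from F.mor_comp[OF F.mor_inv_into[OF G_imp_F[OF j(1)]] lf this]
  have "F.mor ?P \<phi>" using j(2) by (simp add: \<phi>_def)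
  moreover have "\<phi> ` ?P = ?P"
  proof -
    have "\<phi> ` j ` P = l ` f ` P" using \<phi>j by (simp add: image_image)
    then show ?thesis using j(2) l(2) by simp
  qed
  ultimately have "G.mor ?P \<phi>"
    by (intro automorphism_step[OF f0(2) E(1-4) inner]) (simp_all add: IH cardP)
  then have "G.mor P (\<lambda>x. \<phi> (j x))" using G.mor_comp[OF j(1), of ?P \<phi>] j(2) by simp
  then have m: "G.mor P (\<lambda>x. l (f x))" by (rule G.mor_transfer) (rule \<phi>j)
  have "(\<lambda>x. l (f x)) ` P \<subseteq> l ` f ` P" by auto
  from G.mor_comp[OF m G.mor_inv_into[OF l(1)] this]
  have "G.mor P (\<lambda>x. inv_into (f ` P) l (l (f x)))" .
  then show ?case by (rule G.mor_transfer) (simp add: G.mor_inj[OF l(1)])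
qed

end

section \<open>Equality of the two fusion systems\<close>

theorem theorem2:
  fixes p :: nat and S :: "('a, 'b) monoid_scheme"
    and \<G> \<F> :: "'a set \<Rightarrow> 'a set \<Rightarrow> ('a \<Rightarrow> 'a) set"
  assumes "p_group p S"
    and "saturated_fusion_system p S \<G>"
    and "saturated_fusion_system p S \<F>"
    and "\<And>P Q. \<G> P Q \<subseteq> \<F> P Q"
    and "\<And>A B. test_subgroup p S A \<Longrightarrow> test_subgroup p S B \<Longrightarrow> \<G> A B = \<F> A B"
  shows "\<G> = \<F>"
proof -
  interpret group S using assms(1) by (simp add: p_group_def)
  interpret nested_fusion S p \<F> \<G>
    using assms by unfold_locales (auto simp: p_group_def)
  have "\<F> P Q \<subseteq> \<G> P Q" for P Q
    using F_imp_G by (auto simp: F.F_iff G.F_iff)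
  then show ?thesis using assms(4) by (intro ext equalityI) auto
qed

end
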